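(* Let $\mathcal Z=\{x\in U(sl_3)\mid [x,H_1]=[x,H_2]=0\}$ be the centralizer of the Cartan subalgebra in $U(sl_3)$. The algebra $\mathcal Z$ is generated by $$J,\ \overline J,\ K,\ H_1,\ H_2,\ C_2,\ C_3,$$ and its Hilbert--Poincaré series is $$F_{\mathcal Z}(t)=\frac{1+t^3}{(1-t)^2(1-t^2)^3(1-t^3)}.$$
   Context: $sl_3$ is the complex Lie algebra of traceless $3\times3$ matrices, $e_{ij}=E_{ij}-\frac{\delta_{ij}}3I$ ($E_{ij}$ matrix units), and $U(sl_3)$ is its universal enveloping algebra. $H_1=\frac12(e_{11}-e_{22})$, $H_2=\frac12(e_{22}-e_{33})$. $C_2=\sum_{i,j=1}^3e_{ij}e_{ji}$, $C_3=\sum_{i,j,k=1}^3e_{ij}e_{jk}e_{ki}$. $J=\frac{(e_{11}-e_{22})^2+2(e_{11}-e_{22})}{4}+e_{21}e_{12}$, $\overline J=\frac{(e_{11}-e_{33})^2+2(e_{11}-e_{33})}{4}+e_{31}e_{13}$, and $K=[J,\overline J]=e_{31}e_{12}e_{23}-e_{32}e_{21}e_{13}$. $U(sl_3)$ is filtered by assigning degree $1$ to each generator $e_{ij}$ (the standard filtration $U_0\subset U_1\subset\cdots$), and $\mathcal Z$ carries the induced filtration $\mathcal Z_k=\mathcal Z\cap U_k$. The Hilbert--Poincaré series is $F_{\mathcal Z}(t)=\sum_{k\ge0}\dim(\mathcal Z_k/\mathcal Z_{k-1})\,t^k$ (with $\mathcal Z_{-1}=0$). *)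

theory Defs
  imports
    "HOL-Analysis.Analysis"
    "HOL-Library.Poly_Mapping"
    "HOL-Computational_Algebra.Formal_Power_Series"
begin

section \<open>Complex Lie algebras\<close>

class complex_lie_algebra = ab_group_add +
  fixes cscale :: "complex \<Rightarrow> 'a \<Rightarrow> 'a"
    and lie :: "'a \<Rightarrow> 'a \<Rightarrow> 'a"
  assumes cscale_add_right: "cscale c (x + y) = cscale c x + cscale c y"
    and cscale_add_left: "cscale (c + d) x = cscale c x + cscale d x"
    and cscale_cscale: "cscale c (cscale d x) = cscale (c * d) x"
    and cscale_one: "cscale 1 x = x"
    and lie_add_left: "lie (x + y) z = lie x z + lie y z"
    and lie_add_right: "lie x (y + z) = lie x y + lie x z"
    and lie_cscale_left: "lie (cscale c x) y = cscale c (lie x y)"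
    and lie_cscale_right: "lie x (cscale c y) = cscale c (lie x y)"
    and lie_self: "lie x x = 0"
    and jacobi: "lie x (lie y z) + lie y (lie z x) + lie z (lie x y) = 0"

section \<open>Free associative algebras\<close>

text \<open>The free monoid on a type, written additively (empty word \<open>0\<close>, concatenation \<open>+\<close>), so that
  its monoid algebra is available through \<^type>\<open>poly_mapping\<close>.\<close>

typedef 'a free_monoid = "UNIV :: 'a list set"
  morphisms letters Word by simp

setup_lifting type_definition_free_monoid

instantiation free_monoid :: (type) monoid_add
begin
lift_definition zero_free_monoid :: "'a free_monoid" is "[]" .
lift_definition plus_free_monoid :: "'a free_monoid \<Rightarrow> 'a free_monoid \<Rightarrow> 'a free_monoid" is "(@)" .
instance by standard (transfer, simp)+
end

type_synonym 'a free_algebra = "'a free_monoid \<Rightarrow>\<^sub>0 complex"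

definition fa_gen :: "'a \<Rightarrow> 'a free_algebra" where
  "fa_gen x = Poly_Mapping.single (Word [x]) 1"

definition fa_const :: "complex \<Rightarrow> 'a free_algebra" where
  "fa_const c = Poly_Mapping.single 0 c"

definition two_sided_ideal :: "'r::ring_1 set \<Rightarrow> bool" where
  "two_sided_ideal I \<longleftrightarrow>
     0 \<in> I \<and> (\<forall>x\<in>I. \<forall>y\<in>I. x + y \<in> I) \<and> (\<forall>x\<in>I. \<forall>a. a * x \<in> I \<and> x * a \<in> I)"

section \<open>The universal enveloping algebra\<close>

text \<open>The free algebra is taken on the underlying set of the Lie algebra. The first two families of
  relators cut it down to the tensor algebra; the third one is the usual \<open>xy - yx - [x,y]\<close>.\<close>

definition uea_relators :: "'g::complex_lie_algebra free_algebra set" where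
  "uea_relators =
     {fa_gen (x + y) - fa_gen x - fa_gen y | x y. True}
   \<union> {fa_gen (cscale c x) - fa_const c * fa_gen x | c x. True}
   \<union> {fa_gen x * fa_gen y - fa_gen y * fa_gen x - fa_gen (lie x y) | x y. True}"

definition uea_ideal :: "'g::complex_lie_algebra free_algebra set" where
  "uea_ideal = two_sided_ideal hull uea_relators"

definition uea_rel :: "'g::complex_lie_algebra free_algebra \<Rightarrow> 'g free_algebra \<Rightarrow> bool" where
  "uea_rel x y \<longleftrightarrow> x - y \<in> uea_ideal"

lemma two_sided_ideal_uea_ideal: "two_sided_ideal uea_ideal"
  unfolding uea_ideal_def by (rule hull_in) (auto simp: two_sided_ideal_def)

lemma uea_ideal_0: "0 \<in> uea_ideal"
  and uea_ideal_add: "x \<in> uea_ideal \<Longrightarrow> y \<in> uea_ideal \<Longrightarrow> x + y \<in> uea_ideal"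
  and uea_ideal_left: "x \<in> uea_ideal \<Longrightarrow> a * x \<in> uea_ideal"
  and uea_ideal_right: "x \<in> uea_ideal \<Longrightarrow> x * a \<in> uea_ideal"
  using two_sided_ideal_uea_ideal unfolding two_sided_ideal_def by blast+

lemma uea_ideal_uminus: "x \<in> uea_ideal \<Longrightarrow> - x \<in> uea_ideal"
  using uea_ideal_left[of x "-1"] by simp

lemma equivp_uea_rel: "equivp uea_rel"
proof (rule equivpI)
  show "reflp uea_rel" by (simp add: reflp_def uea_rel_def uea_ideal_0)
  show "symp uea_rel"
    unfolding symp_def uea_rel_def using uea_ideal_uminus by fastforce
  show "transp uea_rel"
    unfolding transp_def uea_rel_def using uea_ideal_add by fastforce
qed

quotient_type (overloaded) 'g uea = "'g::complex_lie_algebra free_algebra" / uea_rel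
  by (rule equivp_uea_rel)

text \<open>The augmentation (coefficient of the empty word) shows \<open>0 \<noteq> 1\<close> in the quotient.\<close>

lemma free_monoid_add_eq_0_iff: "(u::'a free_monoid) + v = 0 \<longleftrightarrow> u = 0 \<and> v = 0"
  by transfer simp

lemma free_algebra_induct [case_names zero single add]:
  fixes x :: "'a free_algebra"
  assumes "P 0" and "\<And>u a. P (Poly_Mapping.single u a)"
    and "\<And>x y. P x \<Longrightarrow> P y \<Longrightarrow> P (x + y)"
  shows "P x"
proof (induction x rule: update_induct)
  case (update f u b)
  have "Poly_Mapping.update u b f = f + Poly_Mapping.single u b"
    using update(1)
    by (intro poly_mapping_eqI)
       (auto simp: lookup_update lookup_add lookup_single in_keys_iff when_def)
  then show ?case using assms update by metis
qed (use assms in auto)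

lemma lookup_mult_empty:
  "Poly_Mapping.lookup ((x::'a free_algebra) * y) 0 = Poly_Mapping.lookup x 0 * Poly_Mapping.lookup y 0"
proof (induction x rule: free_algebra_induct)
  case (single u a)
  show ?case
  proof (induction y rule: free_algebra_induct)
    case (single v b)
    show ?case
      by (auto simp: mult_single lookup_single when_def free_monoid_add_eq_0_iff)
  qed (simp_all add: lookup_add distrib_left)
qed (simp_all add: lookup_add distrib_right)

lemma one_notin_uea_ideal: "1 \<notin> uea_ideal"
proof -
  let ?A = "{x :: 'a free_algebra. Poly_Mapping.lookup x 0 = 0}"
  have [simp]: "Word [x] \<noteq> 0" for x :: 'a
    by (simp add: zero_free_monoid_def Word_inject)
  have "two_sided_ideal ?A"
    by (auto simp: two_sided_ideal_def lookup_add lookup_mult_empty)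
  moreover have "uea_relators \<subseteq> ?A"
    by (auto simp: uea_relators_def fa_gen_def lookup_minus lookup_mult_empty lookup_single)
  ultimately have "uea_ideal \<subseteq> ?A"
    unfolding uea_ideal_def by (intro hull_minimal)
  then show ?thesis by (auto simp: lookup_one)
qed

instantiation uea :: (complex_lie_algebra) ring_1
begin
lift_definition zero_uea :: "'a uea" is 0 .
lift_definition one_uea :: "'a uea" is 1 .
lift_definition plus_uea :: "'a uea \<Rightarrow> 'a uea \<Rightarrow> 'a uea" is "(+)"
  unfolding uea_rel_def using uea_ideal_add by (metis add_diff_add)
lift_definition minus_uea :: "'a uea \<Rightarrow> 'a uea \<Rightarrow> 'a uea" is "(-)"
proof -
  fix a b c d :: "'a free_algebra"
  assume "uea_rel a b" "uea_rel c d"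
  then have "(a - b) + - (c - d) \<in> uea_ideal"
    unfolding uea_rel_def by (intro uea_ideal_add uea_ideal_uminus)
  then show "uea_rel (a - c) (b - d)" by (simp add: uea_rel_def algebra_simps)
qed
lift_definition uminus_uea :: "'a uea \<Rightarrow> 'a uea" is uminus
  unfolding uea_rel_def using uea_ideal_uminus by fastforce
lift_definition times_uea :: "'a uea \<Rightarrow> 'a uea \<Rightarrow> 'a uea" is "(*)"
proof -
  fix a b c d :: "'a free_algebra"
  assume "uea_rel a b" "uea_rel c d"
  then have "(a - b) * c + b * (c - d) \<in> uea_ideal"
    unfolding uea_rel_def by (intro uea_ideal_add uea_ideal_left uea_ideal_right)
  then show "uea_rel (a * c) (b * d)" by (simp add: uea_rel_def algebra_simps)
qed
instance
proof
  show "(0::'a uea) \<noteq> 1"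
    by transfer (use uea_ideal_uminus one_notin_uea_ideal in \<open>fastforce simp: uea_rel_def\<close>)
qed (transfer, simp add: uea_rel_def uea_ideal_0 algebra_simps)+
end

lift_definition uea_scale :: "complex \<Rightarrow> 'g::complex_lie_algebra uea \<Rightarrow> 'g uea"
  is "\<lambda>c x. fa_const c * x"
proof -
  fix c and a b :: "'g free_algebra"
  assume "uea_rel a b"
  then have "fa_const c * (a - b) \<in> uea_ideal"
    unfolding uea_rel_def by (rule uea_ideal_left)
  then show "uea_rel (fa_const c * a) (fa_const c * b)"
    by (simp add: uea_rel_def algebra_simps)
qed

lift_definition uea_incl :: "'g::complex_lie_algebra \<Rightarrow> 'g uea" is fa_gen .

interpretation uea: vector_space "uea_scale :: complex \<Rightarrow> 'g::complex_lie_algebra uea \<Rightarrow> 'g uea"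
proof
  fix a b :: complex and x y :: "'g uea"
  show "uea_scale a (x + y) = uea_scale a x + uea_scale a y"
    by transfer (simp add: uea_rel_def uea_ideal_0 algebra_simps)
  show "uea_scale (a + b) x = uea_scale a x + uea_scale b x"
    by transfer (simp add: uea_rel_def uea_ideal_0 fa_const_def single_add algebra_simps)
  show "uea_scale a (uea_scale b x) = uea_scale (a * b) x"
    by transfer (simp add: uea_rel_def uea_ideal_0 fa_const_def mult_single flip: mult.assoc)
  show "uea_scale 1 x = x"
    by transfer (simp add: uea_rel_def uea_ideal_0 fa_const_def)
qed

lemma fa_const_commute: "fa_const c * x = x * fa_const c"
  by (induction x rule: free_algebra_induct)
     (simp_all add: fa_const_def mult_single mult.commute algebra_simps)

lemma uea_scale_mult_left: "uea_scale c x * y = uea_scale c (x * y)"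
  by transfer (simp add: uea_rel_def uea_ideal_0 mult.assoc)

lemma uea_scale_mult_right: "x * uea_scale c y = uea_scale c (x * y)"
  by transfer (metis fa_const_commute mult.assoc equivp_reflp equivp_uea_rel)

lemma uea_relI: "x - y \<in> uea_relators \<Longrightarrow> uea_rel x y"
  unfolding uea_rel_def uea_ideal_def by (rule hull_inc)

lemma uea_incl_add: "uea_incl (x + y) = uea_incl x + uea_incl y"
proof (transfer, rule uea_relI)
  fix x y :: 'a
  have "fa_gen (x + y) - fa_gen x - fa_gen y \<in> uea_relators"
    unfolding uea_relators_def by blast
  then show "fa_gen (x + y) - (fa_gen x + fa_gen y) \<in> uea_relators"
    by (simp only: diff_diff_eq)
qed

lemma uea_incl_cscale: "uea_incl (cscale c x) = uea_scale c (uea_incl x)"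
  by (transfer, rule uea_relI) (unfold uea_relators_def, blast)

lemma uea_incl_lie: "uea_incl (lie x y) = uea_incl x * uea_incl y - uea_incl y * uea_incl x"
proof -
  have "uea_incl x * uea_incl y - uea_incl y * uea_incl x = uea_incl (lie x y)"
    by (transfer, rule uea_relI) (unfold uea_relators_def, blast)
  then show ?thesis by simp
qed

section \<open>The Lie algebra of traceless complex \<open>3 \<times> 3\<close> matrices\<close>

typedef sl3 = "{A :: complex^3^3. trace A = 0}"
  morphisms mat_of_sl3 Sl3 by (rule exI[of _ 0]) (simp add: trace_def)

setup_lifting type_definition_sl3

instantiation sl3 :: complex_lie_algebra
begin
lift_definition zero_sl3 :: sl3 is 0 by (simp add: trace_def)
lift_definition plus_sl3 :: "sl3 \<Rightarrow> sl3 \<Rightarrow> sl3" is "(+)" by (simp add: trace_add)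
lift_definition minus_sl3 :: "sl3 \<Rightarrow> sl3 \<Rightarrow> sl3" is "(-)" by (simp add: trace_sub)
lift_definition uminus_sl3 :: "sl3 \<Rightarrow> sl3" is uminus by (simp add: trace_def sum_negf)
lift_definition cscale_sl3 :: "complex \<Rightarrow> sl3 \<Rightarrow> sl3" is "\<lambda>c A. \<chi> i j. c * A $ i $ j"
  by (simp add: trace_def flip: sum_distrib_left)
lift_definition lie_sl3 :: "sl3 \<Rightarrow> sl3 \<Rightarrow> sl3" is "\<lambda>A B. A ** B - B ** A"
  by (metis trace_sub trace_mul_sym diff_self)
instance
proof
  fix x y z :: sl3 and c d :: complex
  show "x + y + z = x + (y + z)" "x + y = y + x" "0 + x = x" "- x + x = 0" "x - y = x + - y"
    by (transfer, simp)+
  show "cscale c (x + y) = cscale c x + cscale c y"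
    and "cscale (c + d) x = cscale c x + cscale d x"
    and "cscale c (cscale d x) = cscale (c * d) x"
    and "cscale 1 x = x"
    by (transfer, simp add: vec_eq_iff algebra_simps)+
  show "lie (x + y) z = lie x z + lie y z" and "lie x (y + z) = lie x y + lie x z"
    by (transfer, simp add: vec_eq_iff matrix_matrix_mult_def sum.distrib algebra_simps)+
  show "lie (cscale c x) y = cscale c (lie x y)" and "lie x (cscale c y) = cscale c (lie x y)"
    by (transfer,
        simp add: vec_eq_iff matrix_matrix_mult_def right_diff_distrib sum_distrib_left mult_ac)+
  show "lie x x = 0"
    by transfer simp
  have diff: "(A - B) ** C = A ** C - B ** C" "C ** (A - B) = C ** A - C ** B"
    for A B C :: "complex^3^3"
    by (simp_all add: vec_eq_iff matrix_matrix_mult_def sum_subtractf algebra_simps)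
  show "lie x (lie y z) + lie y (lie z x) + lie z (lie x y) = 0"
    by transfer (simp add: diff matrix_mul_assoc)
qed
end

lift_definition sl3_unit :: "3 \<Rightarrow> 3 \<Rightarrow> sl3"
  is "\<lambda>i j. axis i (axis j 1) - mat (if i = j then 1/3 else 0)"
proof -
  fix i j :: 3
  have "axis i (axis j (1::complex)) $ k $ k = (if k = i then if i = j then 1 else 0 else 0)" for k
    by (auto simp: axis_def)
  then have "trace (axis i (axis j (1::complex))) = (if i = j then 1 else 0)"
    by (simp add: trace_def)
  then show "trace (axis i (axis j 1) - mat (if i = j then 1/3 else 0) :: complex^3^3) = 0"
    by (simp add: trace_sub) (simp add: trace_def mat_def)
qed

section \<open>Subalgebras, filtration and Hilbert series\<close>

definition e_gen :: "3 \<Rightarrow> 3 \<Rightarrow> sl3 uea" where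
  "e_gen i j = uea_incl (sl3_unit i j)"

definition commutator :: "'r::ring \<Rightarrow> 'r \<Rightarrow> 'r" where
  "commutator x y = x * y - y * x"

definition subalgebra :: "'g::complex_lie_algebra uea set \<Rightarrow> bool" where
  "subalgebra A \<longleftrightarrow> uea.subspace A \<and> 1 \<in> A \<and> (\<forall>x\<in>A. \<forall>y\<in>A. x * y \<in> A)"

definition sl3_filtration :: "nat \<Rightarrow> sl3 uea set" where
  "sl3_filtration k =
     uea.span {prod_list (map (\<lambda>(i, j). e_gen i j) ps) | ps. length ps \<le> k}"

text \<open>\<open>basis_mod W V B\<close>: the classes of the elements of \<open>B\<close> are pairwise distinct and form a basis of
  the quotient space \<open>V / W\<close> (for subspaces \<open>W \<subseteq> V\<close>). As usual in the library, the dimension is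
  \<open>0\<close> in the infinite-dimensional case.\<close>

definition basis_mod :: "'g::complex_lie_algebra uea set \<Rightarrow> 'g uea set \<Rightarrow> 'g uea set \<Rightarrow> bool" where
  "basis_mod W V B \<longleftrightarrow>
     B \<subseteq> V \<and>
     (\<forall>F c. finite F \<and> F \<subseteq> B \<and> (\<Sum>b\<in>F. uea_scale (c b) b) \<in> W \<longrightarrow> (\<forall>b\<in>F. c b = 0)) \<and>
     (\<forall>v\<in>V. \<exists>F c. finite F \<and> F \<subseteq> B \<and> v - (\<Sum>b\<in>F. uea_scale (c b) b) \<in> W)"

definition quotient_dim :: "'g::complex_lie_algebra uea set \<Rightarrow> 'g uea set \<Rightarrow> nat" where
  "quotient_dim V W = card (SOME B. basis_mod W V B)"

definition hilbert_series :: "sl3 uea set \<Rightarrow> rat fps" where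
  "hilbert_series A = Abs_fps (\<lambda>k. of_nat (quotient_dim
     (A \<inter> sl3_filtration k) (if k = 0 then {0} else A \<inter> sl3_filtration (k - 1))))"

section \<open>Generators and the centralizer of the Cartan subalgebra\<close>

definition H1 :: "sl3 uea" where "H1 = uea_scale (1/2) (e_gen 1 1 - e_gen 2 2)"
definition H2 :: "sl3 uea" where "H2 = uea_scale (1/2) (e_gen 2 2 - e_gen 3 3)"

definition C2 :: "sl3 uea" where "C2 = (\<Sum>i\<in>UNIV. \<Sum>j\<in>UNIV. e_gen i j * e_gen j i)"
definition C3 :: "sl3 uea" where
  "C3 = (\<Sum>i\<in>UNIV. \<Sum>j\<in>UNIV. \<Sum>k\<in>UNIV. e_gen i j * e_gen j k * e_gen k i)"

definition J_elt :: "sl3 uea" where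
  "J_elt = uea_scale (1/4) ((e_gen 1 1 - e_gen 2 2)^2 + 2 * (e_gen 1 1 - e_gen 2 2))
     + e_gen 2 1 * e_gen 1 2"
definition Jbar_elt :: "sl3 uea" where
  "Jbar_elt = uea_scale (1/4) ((e_gen 1 1 - e_gen 3 3)^2 + 2 * (e_gen 1 1 - e_gen 3 3))
     + e_gen 3 1 * e_gen 1 3"
definition K_elt :: "sl3 uea" where "K_elt = commutator J_elt Jbar_elt"

definition cartan_centralizer :: "sl3 uea set" where
  "cartan_centralizer = {x. commutator x H1 = 0 \<and> commutator x H2 = 0}"

lemma matrix_unit_mult:
  "axis i (axis j 1) ** axis k (axis l 1) =
     (if j = k then axis i (axis l 1) else (0 :: complex^3^3))"
proof -
  have "(axis i (axis j 1) ** axis k (axis l 1)) $ a $ b =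
      (if j = k then axis i (axis l 1) else (0 :: complex^3^3)) $ a $ b" for a b
  proof -
    have "axis i (axis j (1::complex)) $ a $ m * axis k (axis l 1) $ m $ b =
        (if m = j then if a = i \<and> j = k \<and> b = l then 1 else 0 else 0)" for m
      by (auto simp: axis_def)
    then show ?thesis
      by (simp add: matrix_matrix_mult_def) (auto simp: axis_def)
  qed
  then show ?thesis by (simp add: vec_eq_iff)
qed

lemma mat_mult: "mat c ** A = (\<chi> i j. c * A $ i $ j)" "A ** mat c = (\<chi> i j. c * A $ i $ j)"
  for A :: "complex^3^3"
proof -
  have "(if i = k then c else 0) * A $ k $ j = (if k = i then c * A $ k $ j else 0)" for i j k by simp
  moreover have "A $ i $ k * (if k = j then c else 0) = (if k = j then c * A $ i $ k else 0)" for i j k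
    by simp
  ultimately show "mat c ** A = (\<chi> i j. c * A $ i $ j)" "A ** mat c = (\<chi> i j. c * A $ i $ j)"
    by (simp_all add: matrix_matrix_mult_def mat_def)
qed

lemma mat_diff_lie:
  fixes A B :: "complex^3^3"
  shows "(A - mat c) ** (B - mat d) - (B - mat d) ** (A - mat c) = A ** B - B ** A"
proof -
  have diff: "(A - B) ** C = A ** C - B ** C" "C ** (A - B) = C ** A - C ** B"
    for A B C :: "complex^3^3"
    by (simp_all add: vec_eq_iff matrix_matrix_mult_def sum_subtractf algebra_simps)
  have "mat c ** mat d = (mat d ** mat c :: complex^3^3)"
    unfolding mat_mult(1) by (simp add: vec_eq_iff mat_def)
  moreover have "mat c ** B = B ** mat c" "mat d ** A = A ** mat d"
    by (simp_all add: mat_mult)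
  ultimately show ?thesis
    by (simp add: diff)
qed

lemma sl3_unit_lie:
  "lie (sl3_unit i j) (sl3_unit k l) =
     (if j = k then sl3_unit i l else 0) - (if l = i then sl3_unit k j else 0)"
  by transfer (simp add: mat_diff_lie matrix_unit_mult)

lemma e_gen_commutator:
  "commutator (e_gen i j) (e_gen k l) =
     (if j = k then e_gen i l else 0) - (if l = i then e_gen k j else 0)"
proof -
  have diff: "uea_incl (x - y) = uea_incl x - uea_incl y" for x y :: sl3
    using uea_incl_add[of "x - y" y] by simp
  have "uea_incl (0::sl3) = 0"
    using diff[of 0 0] by simp
  then show ?thesis
    by (simp add: commutator_def e_gen_def diff sl3_unit_lie flip: uea_incl_lie)
qed

lemma K_elt_eq: "K_elt = e_gen 3 1 * e_gen 1 2 * e_gen 2 3 - e_gen 3 2 * e_gen 2 1 * e_gen 1 3"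
proof -
  have r: "e_gen i j * e_gen k l =
      e_gen k l * e_gen i j + (if j = k then e_gen i l else 0) - (if l = i then e_gen k j else 0)"
    for i j k l
  proof -
    have "e_gen i j * e_gen k l = e_gen k l * e_gen i j + commutator (e_gen i j) (e_gen k l)"
      by (simp add: commutator_def)
    then show ?thesis unfolding e_gen_commutator by (simp only: add_diff_eq)
  qed
  have sq: "(a^2 + 2 * a) * x = x * (a^2 + 2 * a)" if "a * x = x * a" for a x :: "sl3 uea"
  proof -
    have "a * (a * x) = x * (a * a)" using that by (metis mult.assoc)
    then show ?thesis using that
      by (simp add: power2_eq_square distrib_left distrib_right mult.assoc mult_2 mult_2_right)
  qed
  define a b X Y where "a = e_gen 1 1 - e_gen 2 2" and "b = e_gen 1 1 - e_gen 3 3"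
    and "X = e_gen 3 1 * e_gen 1 3" and "Y = e_gen 2 1 * e_gen 1 2"
  have cm: "h * (x * y) = (x * y) * h" if "h * x = x * h + w" "w * y + x * z = 0" "h * y = y * h + z"
    for h x y z w :: "sl3 uea"
  proof -
    have "h * (x * y) = x * (h * y) + w * y" using that(1) by (metis mult.assoc distrib_right)
    also have "\<dots> = x * y * h + (w * y + x * z)" using that(3) by (simp add: algebra_simps)
    finally show ?thesis using that(2) by simp
  qed
  have ab: "a * b = b * a"
    using r[of 1 1 3 3] r[of 2 2 1 1] r[of 2 2 3 3] by (simp add: a_def b_def algebra_simps)
  have aX: "a * X = X * a" unfolding X_def
    by (rule cm[where w = "- e_gen 3 1" and z = "e_gen 1 3"])
       (use r[of 1 1 3 1] r[of 2 2 3 1] r[of 1 1 1 3] r[of 2 2 1 3] in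
         \<open>simp_all add: a_def algebra_simps\<close>)
  have bY: "b * Y = Y * b" unfolding Y_def
    by (rule cm[where w = "- e_gen 2 1" and z = "e_gen 1 2"])
       (use r[of 1 1 2 1] r[of 3 3 2 1] r[of 1 1 1 2] r[of 3 3 1 2] in
         \<open>simp_all add: b_def algebra_simps\<close>)
  define P Q where "P = a^2 + 2 * a" and "Q = b^2 + 2 * b"
  have "P * Q = Q * P" "P * X = X * P" "Q * Y = Y * Q"
    unfolding P_def Q_def using aX bY sq[OF ab] sq[of b "a^2 + 2 * a"] by (simp_all add: sq)
  moreover have "K_elt = commutator (uea_scale (1/4) P + Y) (uea_scale (1/4) Q + X)"
    by (simp add: K_elt_def J_elt_def Jbar_elt_def P_def Q_def a_def b_def X_def Y_def)
  ultimately have "K_elt = Y * X - X * Y"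
    by (simp add: commutator_def distrib_left distrib_right uea_scale_mult_left
        uea_scale_mult_right uea.scale_right_distrib)
  also have "Y * X = X * Y + e_gen 3 1 * (e_gen 2 3 * e_gen 1 2) - e_gen 2 1 * e_gen 3 2 * e_gen 1 3"
  proof -
    have s1: "e_gen 1 2 * e_gen 3 1 = e_gen 3 1 * e_gen 1 2 - e_gen 3 2" using r[of 1 2 3 1] by simp
    have s2: "e_gen 1 2 * e_gen 1 3 = e_gen 1 3 * e_gen 1 2" using r[of 1 2 1 3] by simp
    have s3: "e_gen 2 1 * e_gen 3 1 = e_gen 3 1 * e_gen 2 1" using r[of 2 1 3 1] by simp
    have s4: "e_gen 2 1 * e_gen 1 3 = e_gen 1 3 * e_gen 2 1 + e_gen 2 3" using r[of 2 1 1 3] by simp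
    have "Y * X = e_gen 2 1 * (e_gen 1 2 * e_gen 3 1) * e_gen 1 3"
      by (simp add: X_def Y_def mult.assoc)
    also have "\<dots> = (e_gen 2 1 * e_gen 3 1) * (e_gen 1 2 * e_gen 1 3) - e_gen 2 1 * e_gen 3 2 * e_gen 1 3"
      unfolding s1 by (simp only: distrib_left distrib_right left_diff_distrib right_diff_distrib mult.assoc)
    also have "(e_gen 2 1 * e_gen 3 1) * (e_gen 1 2 * e_gen 1 3) = e_gen 3 1 * (e_gen 2 1 * e_gen 1 3) * e_gen 1 2"
      unfolding s2 s3 by (simp only: mult.assoc)
    also have "\<dots> = X * Y + e_gen 3 1 * (e_gen 2 3 * e_gen 1 2)"
      unfolding s4 X_def Y_def by (simp only: distrib_left distrib_right mult.assoc)
    finally show ?thesis .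
  qed
  also have "e_gen 2 3 * e_gen 1 2 = e_gen 1 2 * e_gen 2 3 - e_gen 1 3" using r[of 2 3 1 2] by simp
  also have "e_gen 2 1 * e_gen 3 2 = e_gen 3 2 * e_gen 2 1 - e_gen 3 1" using r[of 2 1 3 2] by simp
  finally show ?thesis
    by (simp add: left_diff_distrib right_diff_distrib mult.assoc)
qed

end

theory Submission
  imports Defs
begin

text \<open>
  Modulo terms of lower degree the factors of a monomial in the \<open>e\<^sub>i\<^sub>j\<close> may be permuted, so the monomials
  indexed by multisets over the eight letters \<open>(i, j) \<noteq> (2, 2)\<close> span; \<open>e\<^sub>2\<^sub>2 = - e\<^sub>1\<^sub>1 - e\<^sub>3\<^sub>3\<close> is redundant.
  Their linear independence comes from dual functionals: functionals on the enveloping algebra are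
  multiplied by convolution, which on words is the shuffle product, and a product of \<open>d\<close> functionals
  that vanish at \<open>1\<close> kills all words shorter than \<open>d\<close> and is a permanent on words of length \<open>d\<close>. Applying
  this to the eight coordinate functionals of the defining representation separates the monomials
  of top degree.

  The monomials are eigenvectors of the Cartan subalgebra, so those of weight zero are a basis of the
  centralizer. Regarding a letter \<open>(i, j)\<close> as an edge from \<open>i\<close> to \<open>j\<close>, weight zero means that the
  multigraph is balanced, hence a union of directed cycles. Up to lower order, each cycle of length
  at most 3 is expressed by the seven given elements; this yields the generators by induction on the
  degree. A balanced multigraph is uniquely determined by the multiplicities of the five cycles of
  length at most 2 (without \<open>(2, 2)\<close>) and an integer which counts the triangles of one of the two
  orientations; this yields the Hilbert series.
\<close>

section \<open>Linear functionals on the enveloping algebra\<close>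

definition linear_ext :: "('a list \<Rightarrow> complex) \<Rightarrow> 'a free_algebra \<Rightarrow> complex" where
  "linear_ext \<phi> x = (\<Sum>u\<in>Poly_Mapping.keys x. Poly_Mapping.lookup x u * \<phi> (letters u))"

lemma linear_ext_superset:
  assumes "finite S" "Poly_Mapping.keys x \<subseteq> S"
  shows "linear_ext \<phi> x = (\<Sum>u\<in>S. Poly_Mapping.lookup x u * \<phi> (letters u))"
  unfolding linear_ext_def using assms
  by (intro sum.mono_neutral_left) (auto simp: in_keys_iff)

lemma linear_ext_add: "linear_ext \<phi> (x + y) = linear_ext \<phi> x + linear_ext \<phi> y"
proof -
  let ?S = "Poly_Mapping.keys x \<union> Poly_Mapping.keys y"
  have "Poly_Mapping.keys (x + y) \<subseteq> ?S" by (rule keys_add)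
  then show ?thesis
    by (simp add: linear_ext_superset[of ?S] lookup_add distrib_right sum.distrib)
qed

lemma linear_ext_zero [simp]: "linear_ext \<phi> 0 = 0"
  by (simp add: linear_ext_def)

lemma linear_ext_single: "linear_ext \<phi> (Poly_Mapping.single u a) = a * \<phi> (letters u)"
  by (simp add: linear_ext_superset[of "{u}"])

lemma linear_ext_minus: "linear_ext \<phi> (x - y) = linear_ext \<phi> x - linear_ext \<phi> y"
  using linear_ext_add[of \<phi> "x - y" y] by simp

lemma linear_ext_const_mult: "linear_ext \<phi> (fa_const c * x) = c * linear_ext \<phi> x"
  by (induction x rule: free_algebra_induct)
     (simp_all add: linear_ext_add linear_ext_single fa_const_def mult_single algebra_simps)

lemma letters_plus: "letters (u + v) = letters u @ letters v"
  by (fact plus_free_monoid.rep_eq)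

text \<open>Each clause expresses vanishing on one family of relators placed between words
  \<open>u\<close> and \<open>v\<close>; together they single out the functionals on words that
  descend to the quotient.\<close>

definition uea_form :: "('g::complex_lie_algebra list \<Rightarrow> complex) \<Rightarrow> bool" where
  "uea_form \<phi> \<longleftrightarrow>
     (\<forall>u x y v. \<phi> (u @ (x + y) # v) = \<phi> (u @ x # v) + \<phi> (u @ y # v)) \<and>
     (\<forall>u c x v. \<phi> (u @ cscale c x # v) = c * \<phi> (u @ x # v)) \<and>
     (\<forall>u x y v. \<phi> (u @ x # y # v) = \<phi> (u @ y # x # v) + \<phi> (u @ lie x y # v))"

text \<open>The \<open>x\<close> with \<open>linear_ext \<phi> (a * x * b) = 0\<close> for all
  \<open>a\<close> and \<open>b\<close> form a two-sided ideal inside the kernel, so only the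
  relators have to be checked.\<close>

lemma linear_ext_ideal:
  fixes \<phi> :: "'g::complex_lie_algebra list \<Rightarrow> complex"
  assumes \<phi>: "uea_form \<phi>" and x: "x \<in> uea_ideal"
  shows "linear_ext \<phi> x = 0"
proof -
  let ?A = "{x. \<forall>a b. linear_ext \<phi> (a * x * b) = 0}"
  have 1: "two_sided_ideal ?A"
    unfolding two_sided_ideal_def
  proof (intro conjI ballI allI)
    fix x y a assume x: "x \<in> ?A"
    { assume "y \<in> ?A" with x show "x + y \<in> ?A"
        by (simp add: distrib_left distrib_right linear_ext_add) }
    have "linear_ext \<phi> (b * (a * x) * c) = 0" "linear_ext \<phi> (b * (x * a) * c) = 0" for b c
    proof -
      have "linear_ext \<phi> ((b * a) * x * c) = 0" "linear_ext \<phi> (b * x * (a * c)) = 0"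
        using x by blast+
      then show "linear_ext \<phi> (b * (a * x) * c) = 0" "linear_ext \<phi> (b * (x * a) * c) = 0"
        by (simp_all add: mult.assoc)
    qed
    then show "a * x \<in> ?A" "x * a \<in> ?A" by auto
  qed simp
  \<comment> \<open>Scalars are central and the functional is linear, so both outer factors may be
    taken to be single words.\<close>
  have words: "x \<in> ?A"
    if "\<And>u v. linear_ext \<phi> (Poly_Mapping.single u 1 * x * Poly_Mapping.single v 1) = 0" for x
  proof -
    have s: "Poly_Mapping.single u c = fa_const c * Poly_Mapping.single u 1"
      for u :: "'g free_monoid" and c by (simp add: fa_const_def mult_single)
    have "linear_ext \<phi> (Poly_Mapping.single u c * x * Poly_Mapping.single v d) = 0" for u v c d
    proof -
      have "Poly_Mapping.single u c * x * Poly_Mapping.single v d =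
          fa_const c * Poly_Mapping.single u 1 * x * (Poly_Mapping.single v 1 * fa_const d)"
        by (simp only: s[of u c] s[of v d] fa_const_commute[of d])
      also have "\<dots> = fa_const c * (fa_const d * (Poly_Mapping.single u 1 * x * Poly_Mapping.single v 1))"
        unfolding fa_const_commute[of d] by (simp only: mult.assoc)
      finally have "Poly_Mapping.single u c * x * Poly_Mapping.single v d =
          fa_const c * (fa_const d * (Poly_Mapping.single u 1 * x * Poly_Mapping.single v 1))" .
      then show ?thesis by (simp add: linear_ext_const_mult that)
    qed
    then have "linear_ext \<phi> (Poly_Mapping.single u c * x * b) = 0" for u c b
      by (induction b rule: free_algebra_induct) (simp_all add: distrib_left linear_ext_add)
    then have "linear_ext \<phi> (a * x * b) = 0" for a b
      by (induction a rule: free_algebra_induct) (simp_all add: distrib_right linear_ext_add)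
    then show ?thesis by simp
  qed
  have 2: "uea_relators \<subseteq> ?A"
  proof
    fix r assume r: "r \<in> (uea_relators :: 'g free_algebra set)"
    have "linear_ext \<phi> (Poly_Mapping.single u 1 * r * Poly_Mapping.single v 1) = 0" for u v
    proof -
      have f: "\<phi> (letters u @ (x + y) # letters v) =
          \<phi> (letters u @ x # letters v) + \<phi> (letters u @ y # letters v)"
        "\<phi> (letters u @ cscale c x # letters v) = c * \<phi> (letters u @ x # letters v)"
        "\<phi> (letters u @ x # y # letters v) =
          \<phi> (letters u @ y # x # letters v) + \<phi> (letters u @ lie x y # letters v)" for x y c
        using \<phi> unfolding uea_form_def by blast+
      note s = fa_gen_def fa_const_def mult_single linear_ext_single linear_ext_minus
        left_diff_distrib right_diff_distrib letters_plus Word_inverse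
      from r consider x y where "r = fa_gen (x + y) - fa_gen x - fa_gen y"
        | c x where "r = fa_gen (cscale c x) - fa_const c * fa_gen x"
        | x y where "r = fa_gen x * fa_gen y - fa_gen y * fa_gen x - fa_gen (lie x y)"
        unfolding uea_relators_def by blast
      then show ?thesis
      proof cases
        case 1
        then show ?thesis by (simp add: s f(1))
      next
        case 2
        then show ?thesis by (simp add: s f(2))
      next
        case (3 x y)
        then show ?thesis by (simp add: s f(3)[of x y])
      qed
    qed
    then show "r \<in> ?A" by (rule words)
  qed
  from 1 2 have "uea_ideal \<subseteq> ?A"
    unfolding uea_ideal_def by (intro hull_minimal)
  with x have "linear_ext \<phi> (1 * x * 1) = 0" by blast
  then show ?thesis by simp
qed

text \<open>The default 0 for a \<open>\<phi>\<close> that is not a form makes the map respect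
  \<open>uea_rel\<close> unconditionally, so that it lifts and is linear without hypotheses.\<close>

lift_definition uea_eval :: "('g list \<Rightarrow> complex) \<Rightarrow> 'g::complex_lie_algebra uea \<Rightarrow> complex"
  is "\<lambda>\<phi> x. if uea_form \<phi> then linear_ext \<phi> x else 0"
proof -
  fix \<phi> :: "'g list \<Rightarrow> complex" and x y :: "'g free_algebra"
  assume "uea_rel x y"
  then show "(if uea_form \<phi> then linear_ext \<phi> x else 0) = (if uea_form \<phi> then linear_ext \<phi> y else 0)"
    using linear_ext_ideal[of \<phi> "x - y"] by (simp add: uea_rel_def linear_ext_minus)
qed

lemma uea_eval_zero [simp]: "uea_eval \<phi> 0 = 0"
  by transfer simp

lemma uea_eval_add: "uea_eval \<phi> (x + y) = uea_eval \<phi> x + uea_eval \<phi> y"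
  by transfer (simp add: linear_ext_add)

lemma uea_eval_scale: "uea_eval \<phi> (uea_scale c x) = c * uea_eval \<phi> x"
  by transfer (simp add: linear_ext_const_mult)

lemma uea_eval_sum: "uea_eval \<phi> (\<Sum>i\<in>I. f i) = (\<Sum>i\<in>I. uea_eval \<phi> (f i))"
  by (induction I rule: infinite_finite_induct) (simp_all add: uea_eval_add)

definition uea_word :: "'g::complex_lie_algebra list \<Rightarrow> 'g uea" where
  "uea_word xs = prod_list (map uea_incl xs)"

lemma uea_word_abs: "uea_word xs = abs_uea (Poly_Mapping.single (Word xs) 1)"
proof (induction xs)
  case Nil
  have "Poly_Mapping.single (Word []) 1 = (1 :: 'a free_algebra)"
    by (simp flip: zero_free_monoid_def)
  then show ?case by (simp add: uea_word_def one_uea.abs_eq)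
next
  case (Cons x xs)
  have "fa_gen x * Poly_Mapping.single (Word xs) 1 = Poly_Mapping.single (Word (x # xs)) 1"
    by (simp add: fa_gen_def mult_single plus_free_monoid.abs_eq)
  then show ?case using Cons
    by (simp add: uea_word_def uea_incl.abs_eq times_uea.abs_eq)
qed

lemma uea_eval_word: "uea_form \<phi> \<Longrightarrow> uea_eval \<phi> (uea_word xs) = \<phi> xs"
  by (simp add: uea_word_abs uea_eval.abs_eq linear_ext_single Word_inverse)

lemma uea_word_span: "x \<in> uea.span (range uea_word)"
proof (induction x)
  case (1 y)
  show ?case
  proof (induction y rule: free_algebra_induct)
    case zero
    then show ?case by (simp flip: zero_uea.abs_eq add: uea.span_zero)
  next
    case (single u a)
    have "Poly_Mapping.single u a = fa_const a * Poly_Mapping.single (Word (letters u)) 1"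
      by (simp add: fa_const_def mult_single letters_inverse)
    then have "abs_uea (Poly_Mapping.single u a) = uea_scale a (uea_word (letters u))"
      by (simp add: uea_word_abs uea_scale.abs_eq)
    then show ?case by (simp add: uea.span_base uea.span_scale)
  next
    case (add x y)
    then show ?case by (simp flip: plus_uea.abs_eq add: uea.span_add)
  qed
qed

text \<open>The convolution product for the coproduct that makes the elements of the Lie algebra primitive;
  peeling off the first letter is a derivation, which is why the product of two forms is a form.\<close>

fun shuffle_prod :: "('a list \<Rightarrow> complex) \<Rightarrow> ('a list \<Rightarrow> complex) \<Rightarrow> 'a list \<Rightarrow> complex" where
  "shuffle_prod \<phi> \<psi> [] = \<phi> [] * \<psi> []"
| "shuffle_prod \<phi> \<psi> (x # w) =
     shuffle_prod (\<lambda>v. \<phi> (x # v)) \<psi> w + shuffle_prod \<phi> (\<lambda>v. \<psi> (x # v)) w"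

lemma shuffle_prod_add:
  "shuffle_prod (\<lambda>v. \<phi> v + \<phi>' v) \<psi> w = shuffle_prod \<phi> \<psi> w + shuffle_prod \<phi>' \<psi> w"
  "shuffle_prod \<phi> (\<lambda>v. \<psi> v + \<psi>' v) w = shuffle_prod \<phi> \<psi> w + shuffle_prod \<phi> \<psi>' w"
  by (induction w arbitrary: \<phi> \<phi>' \<psi> \<psi>') (simp_all add: algebra_simps)

lemma shuffle_prod_scale:
  "shuffle_prod (\<lambda>v. c * \<phi> v) \<psi> w = c * shuffle_prod \<phi> \<psi> w"
  "shuffle_prod \<phi> (\<lambda>v. c * \<psi> v) w = c * shuffle_prod \<phi> \<psi> w"
  by (induction w arbitrary: \<phi> \<psi>) (simp_all add: algebra_simps)

lemma uea_formD:
  assumes "uea_form \<phi>"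
  shows "\<phi> (u @ (x + y) # v) = \<phi> (u @ x # v) + \<phi> (u @ y # v)"
    and "\<phi> (u @ cscale c x # v) = c * \<phi> (u @ x # v)"
    and "\<phi> (u @ x # y # v) = \<phi> (u @ y # x # v) + \<phi> (u @ lie x y # v)"
  using assms unfolding uea_form_def by blast+

lemma uea_formD_Nil:
  assumes "uea_form \<phi>"
  shows "\<phi> ((x + y) # v) = \<phi> (x # v) + \<phi> (y # v)"
    and "\<phi> (cscale c x # v) = c * \<phi> (x # v)"
    and "\<phi> (x # y # v) = \<phi> (y # x # v) + \<phi> (lie x y # v)"
  by (fact uea_formD[OF assms, where u = "[]", unfolded append_Nil])+

lemma uea_form_Cons:
  assumes "uea_form \<phi>"
  shows "uea_form (\<lambda>v. \<phi> (a # v))"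
  unfolding uea_form_def 
  by (intro conjI allI uea_formD[OF assms, where u = "a # u" for u, unfolded append_Cons])

text \<open>The letters of \<open>u\<close> are peeled off one by one, and both arguments remain
  forms. In the bracket clause the mixed terms, with \<open>x\<close> and \<open>y\<close> in
  different factors, are symmetric in \<open>x\<close> and \<open>y\<close>, so only the bracket
  terms of the two factors survive.\<close>

lemma uea_form_shuffle_prod:
  assumes "uea_form \<phi>" "uea_form \<psi>"
  shows "uea_form (shuffle_prod \<phi> \<psi>)"
proof -
  have "shuffle_prod \<phi> \<psi> (u @ (x + y) # v) =
      shuffle_prod \<phi> \<psi> (u @ x # v) + shuffle_prod \<phi> \<psi> (u @ y # v)" for u x y v
    using assms
  proof (induction u arbitrary: \<phi> \<psi>)
    case Nil
    note * = uea_formD_Nil(1)[OF Nil(1)] uea_formD_Nil(1)[OF Nil(2)]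
    show ?case by (simp add: * shuffle_prod_add)
  next
    case (Cons a u)
    show ?case
      using Cons.IH[OF uea_form_Cons[OF Cons.prems(1)] Cons.prems(2), of a]
        Cons.IH[OF Cons.prems(1) uea_form_Cons[OF Cons.prems(2)], of a]
      by (simp add: algebra_simps)
  qed
  moreover have "shuffle_prod \<phi> \<psi> (u @ cscale c x # v) = c * shuffle_prod \<phi> \<psi> (u @ x # v)"
    for u c x v
    using assms
  proof (induction u arbitrary: \<phi> \<psi>)
    case Nil
    note * = uea_formD_Nil(2)[OF Nil(1)] uea_formD_Nil(2)[OF Nil(2)]
    show ?case by (simp add: * shuffle_prod_scale distrib_left)
  next
    case (Cons a u)
    show ?case
      using Cons.IH[OF uea_form_Cons[OF Cons.prems(1)] Cons.prems(2), of a]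
        Cons.IH[OF Cons.prems(1) uea_form_Cons[OF Cons.prems(2)], of a]
      by (simp add: algebra_simps)
  qed
  moreover have "shuffle_prod \<phi> \<psi> (u @ x # y # v) =
      shuffle_prod \<phi> \<psi> (u @ y # x # v) + shuffle_prod \<phi> \<psi> (u @ lie x y # v)" for u x y v
    using assms
  proof (induction u arbitrary: \<phi> \<psi>)
    case Nil
    note * = uea_formD_Nil(3)[OF Nil(1), of x y] uea_formD_Nil(3)[OF Nil(2), of x y]
    show ?case by (simp add: * shuffle_prod_add)
  next
    case (Cons a u)
    show ?case
      using Cons.IH[OF uea_form_Cons[OF Cons.prems(1)] Cons.prems(2), of a]
        Cons.IH[OF Cons.prems(1) uea_form_Cons[OF Cons.prems(2)], of a]
      by (simp add: algebra_simps)
  qed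
  ultimately show ?thesis unfolding uea_form_def by blast
qed

section \<open>Lowest-degree terms of shuffle products\<close>

definition vanishes_below :: "nat \<Rightarrow> ('a list \<Rightarrow> complex) \<Rightarrow> bool" where
  "vanishes_below k \<phi> \<longleftrightarrow> (\<forall>w. length w < k \<longrightarrow> \<phi> w = 0)"

lemma vanishes_below_Cons: "vanishes_below k \<phi> \<Longrightarrow> vanishes_below (k - 1) (\<lambda>v. \<phi> (x # v))"
  by (auto simp: vanishes_below_def)

text \<open>A shuffle product sums over the ways to split a word into two complementary subwords; if
  the word is shorter than \<open>k + l\<close>, one of them is too short.\<close>

lemma vanishes_below_shuffle_prod:
  assumes "vanishes_below k \<phi>" "vanishes_below l \<psi>"
  shows "vanishes_below (k + l) (shuffle_prod \<phi> \<psi>)"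
proof -
  have "shuffle_prod \<phi> \<psi> w = 0" if "length w < k + l" for w
    using assms that
  proof (induction w arbitrary: k l \<phi> \<psi>)
    case Nil
    then show ?case by (auto simp: vanishes_below_def)
  next
    case (Cons x w)
    have "shuffle_prod (\<lambda>v. \<phi> (x # v)) \<psi> w = 0"
      using Cons.prems(3)
      by (intro Cons.IH[OF vanishes_below_Cons[OF Cons.prems(1)] Cons.prems(2)]) auto
    moreover have "shuffle_prod \<phi> (\<lambda>v. \<psi> (x # v)) w = 0"
      using Cons.prems(3)
      by (intro Cons.IH[OF Cons.prems(1) vanishes_below_Cons[OF Cons.prems(2)]]) auto
    ultimately show ?case by simp
  qed
  then show ?thesis by (simp add: vanishes_below_def)
qed

text \<open>Only the split that hands all of \<open>w\<close> to \<open>\<psi>\<close>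
  contributes.\<close>

lemma shuffle_prod_top_0:
  assumes "vanishes_below (length w) \<psi>"
  shows "shuffle_prod \<phi> \<psi> w = \<phi> [] * \<psi> w"
  using assms
proof (induction w arbitrary: \<psi>)
  case (Cons x w)
  have "vanishes_below (0 + length (x # w)) (shuffle_prod (\<lambda>v. \<phi> (x # v)) \<psi>)"
    using Cons.prems by (intro vanishes_below_shuffle_prod) (auto simp: vanishes_below_def)
  then have "shuffle_prod (\<lambda>v. \<phi> (x # v)) \<psi> w = 0" by (simp add: vanishes_below_def)
  then show ?case using Cons.IH[of "\<lambda>v. \<psi> (x # v)"] vanishes_below_Cons[OF Cons.prems, of x] by simp
qed simp

text \<open>\<open>\<phi>\<close> needs at least one letter and \<open>\<psi>\<close> at least
  \<open>d\<close>, so exactly one letter goes to \<open>\<phi>\<close>.\<close>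

lemma shuffle_prod_top_1:
  assumes "\<phi> [] = 0" "length w = Suc d" "vanishes_below d \<psi>"
  shows "shuffle_prod \<phi> \<psi> w = (\<Sum>i<length w. \<phi> [w ! i] * \<psi> (take i w @ drop (Suc i) w))"
  using assms(2,3)
proof (induction w arbitrary: d \<psi>)
  case (Cons x w)
  note IH = Cons.IH and prems = Cons.prems
  have d: "d = length w" using prems by simp
  have "shuffle_prod (\<lambda>v. \<phi> (x # v)) \<psi> w = \<phi> [x] * \<psi> w"
    using prems by (intro shuffle_prod_top_0) (simp add: d)
  moreover
  have "shuffle_prod \<phi> (\<lambda>v. \<psi> (x # v)) w =
      (\<Sum>i<length w. \<phi> [w ! i] * \<psi> (x # take i w @ drop (Suc i) w))"
  \<comment> \<open>The induction hypothesis speaks of words of length \<open>Suc d\<close>; for the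
    empty word both sides are 0 because of \<open>\<phi> [] = 0\<close>.\<close>
  proof (cases w)
    case Nil
    then show ?thesis using assms(1) by simp
  next
    case (Cons y v)
    have "length w = Suc (d - 1)" using Cons d by simp
    from IH[OF this vanishes_below_Cons[OF prems(2)]] show ?thesis .
  qed
  ultimately show ?case
    by (simp del: sum.lessThan_Suc add: sum.lessThan_Suc_shift)
qed simp

section \<open>Linear independence of the monomials\<close>

definition sl3_matrix_prod :: "sl3 list \<Rightarrow> complex^3^3" where
  "sl3_matrix_prod w = foldr (\<lambda>x A. mat_of_sl3 x ** A) w (mat 1)"

lemma sl3_matrix_prod_simps [simp]:
  "sl3_matrix_prod [] = mat 1"
  "sl3_matrix_prod (x # w) = mat_of_sl3 x ** sl3_matrix_prod w"
  by (simp_all add: sl3_matrix_prod_def)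

lemma sl3_matrix_prod_append:
  "sl3_matrix_prod (u @ v) = sl3_matrix_prod u ** sl3_matrix_prod v"
  by (induction u) (simp_all add: matrix_mul_assoc)

text \<open>Subtracting the \<open>(2, 2)\<close> entry makes the functionals vanish on the identity matrix, and makes the
  eight functionals for \<open>p \<noteq> (2, 2)\<close> dual to the corresponding \<^const>\<open>sl3_unit\<close>.\<close>

definition coord_form :: "3 \<times> 3 \<Rightarrow> sl3 list \<Rightarrow> complex" where
  "coord_form p w = sl3_matrix_prod w $ fst p $ snd p - (if fst p = snd p then sl3_matrix_prod w $ 2 $ 2 else 0)"

lemma coord_form_Nil [simp]: "coord_form p [] = 0"
  by (simp add: coord_form_def mat_def)

lemma sl3_unit_nth:
  "mat_of_sl3 (sl3_unit k l) $ i $ j =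
     (if i = k \<and> j = l then 1 else 0) - (if i = j \<and> k = l then 1/3 else 0)"
  by (simp add: sl3_unit.rep_eq axis_def mat_def)

lemma coord_form_unit:
  assumes "q \<noteq> (2, 2)"
  shows "coord_form p [sl3_unit (fst q) (snd q)] = (if p = q then 1 else 0)"
proof -
  have "\<not> (2 = fst q \<and> 2 = snd q)"
    using assms by (metis prod.collapse)
  then show ?thesis
    by (auto simp: coord_form_def sl3_unit_nth prod_eq_iff)
qed

text \<open>Entries of \<open>sl3_matrix_prod\<close> are matrix coefficients of the defining
  representation, in which \<open>lie\<close> acts as the matrix commutator.\<close>

lemma uea_form_coord_form: "uea_form (coord_form p)"
proof -
  have lin: "A ** (B + C) = A ** B + A ** C" "(B + C) ** A = B ** A + C ** A"
    "A ** (B - C) = A ** B - A ** C" "(B - C) ** A = B ** A - C ** A"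
    "A ** (\<chi> i j. c * B $ i $ j) = (\<chi> i j. c * (A ** B) $ i $ j)"
    "(\<chi> i j. c * B $ i $ j) ** A = (\<chi> i j. c * (B ** A) $ i $ j)"
    for A B C :: "complex^3^3" and c
    by (simp_all add: vec_eq_iff matrix_matrix_mult_def sum.distrib sum_subtractf sum_distrib_left
        algebra_simps)
  note s = coord_form_def sl3_matrix_prod_append sl3_matrix_prod_simps lin
  show ?thesis
    unfolding uea_form_def
  proof (intro conjI allI)
    fix u x y v and c :: complex
    show "coord_form p (u @ (x + y) # v) = coord_form p (u @ x # v) + coord_form p (u @ y # v)"
      by (simp add: s plus_sl3.rep_eq)
    show "coord_form p (u @ cscale c x # v) = c * coord_form p (u @ x # v)"
      by (simp add: s cscale_sl3.rep_eq right_diff_distrib)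
    show "coord_form p (u @ x # y # v) = coord_form p (u @ y # x # v) + coord_form p (u @ lie x y # v)"
      by (simp add: s lie_sl3.rep_eq matrix_mul_assoc)
  qed
qed

text \<open>The empty product is the counit, which is the unit for convolution.\<close>

fun coord_forms :: "(3 \<times> 3) list \<Rightarrow> sl3 list \<Rightarrow> complex" where
  "coord_forms [] = (\<lambda>w. if w = [] then 1 else 0)"
| "coord_forms (p # ps) = shuffle_prod (coord_form p) (coord_forms ps)"

lemma uea_form_coord_forms: "uea_form (coord_forms ps)"
proof (induction ps)
  case Nil
  show ?case by (simp add: uea_form_def)
qed (simp add: uea_form_shuffle_prod uea_form_coord_form)

lemma vanishes_below_coord_forms: "vanishes_below (length ps) (coord_forms ps)"
proof (induction ps)
  case Nil
  show ?case by (simp add: vanishes_below_def)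
next
  case (Cons p ps)
  have "vanishes_below 1 (coord_form p)" by (simp add: vanishes_below_def)
  from vanishes_below_shuffle_prod[OF this Cons] show ?case by simp
qed

abbreviation unit_word :: "(3 \<times> 3) list \<Rightarrow> sl3 list" where
  "unit_word \<equiv> map (\<lambda>(i, j). sl3_unit i j)"

text \<open>For lists of equal length this is the permanent of the 0/1 matrix recording which
  letters of \<open>ps\<close> and \<open>qs\<close> agree, expanded along the first letter of
  \<open>ps\<close>.\<close>

fun arrangements :: "'a list \<Rightarrow> 'a list \<Rightarrow> nat" where
  "arrangements [] qs = (if qs = [] then 1 else 0)"
| "arrangements (p # ps) qs =
     (\<Sum>i<length qs. (if qs ! i = p then arrangements ps (take i qs @ drop (Suc i) qs) else 0))"

text \<open>Natural summands cannot cancel, so positivity means that some letter of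
  \<open>qs\<close> equals the first letter of \<open>ps\<close> and the remaining letters match as
  multisets.\<close>

lemma arrangements_pos_iff: "arrangements ps qs > 0 \<longleftrightarrow> mset ps = mset qs"
proof (induction ps arbitrary: qs)
  case (Cons p ps)
  have split: "mset qs = add_mset (qs ! i) (mset (take i qs @ drop (Suc i) qs))" if "i < length qs" for i
    using arg_cong[OF id_take_nth_drop[OF that], of mset] by simp
  have "arrangements (p # ps) qs > 0 \<longleftrightarrow>
      (\<exists>i<length qs. qs ! i = p \<and> mset ps = mset (take i qs @ drop (Suc i) qs))"
    using Cons by (auto simp: sum_eq_0_iff simp flip: neq0_conv)
  also have "\<dots> \<longleftrightarrow> mset (p # ps) = mset qs" (is "?L \<longleftrightarrow> ?R")
  proof
    assume ?L
    then show ?R using split by auto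
  next
    assume R: ?R
    then have "p \<in> set qs" by (metis list.set_intros(1) set_mset_mset)
    then obtain i where "i < length qs" "qs ! i = p" by (auto simp: in_set_conv_nth)
    with R split[of i] show ?L by auto
  qed
  finally show ?case .
qed auto

text \<open>\<open>shuffle_prod_top_1\<close> is the row expansion of the permanent, and duality of
  \<open>coord_form\<close> to the units turns the matrix entries into 0 or 1.\<close>

lemma coord_forms_unit_word:
  assumes "length ps = length qs" "(2, 2) \<notin> set ps" "(2, 2) \<notin> set qs"
  shows "coord_forms ps (unit_word qs) = of_nat (arrangements ps qs)"
  using assms
proof (induction ps arbitrary: qs)
  case (Cons p ps)
  have "coord_forms (p # ps) (unit_word qs) =
      (\<Sum>i<length qs. coord_form p [unit_word qs ! i] *
        coord_forms ps (take i (unit_word qs) @ drop (Suc i) (unit_word qs)))"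
    using Cons.prems vanishes_below_coord_forms[of ps]
    by (simp add: shuffle_prod_top_1[where d = "length ps"])
  also have "\<dots> = (\<Sum>i<length qs. of_nat (if qs ! i = p
      then arrangements ps (take i qs @ drop (Suc i) qs) else 0))"
  proof (intro sum.cong refl)
    fix i assume i: "i \<in> {..<length qs}"
    have "coord_forms ps (unit_word (take i qs @ drop (Suc i) qs)) =
        of_nat (arrangements ps (take i qs @ drop (Suc i) qs))"
      using Cons.prems i by (intro Cons.IH) (auto dest: in_set_takeD in_set_dropD)
    moreover have "qs ! i \<noteq> (2, 2)" using Cons.prems i by (metis lessThan_iff nth_mem)
    ultimately show "coord_form p [unit_word qs ! i] *
        coord_forms ps (take i (unit_word qs) @ drop (Suc i) (unit_word qs)) =
        of_nat (if qs ! i = p then arrangements ps (take i qs @ drop (Suc i) qs) else 0)"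
      using i Cons.prems coord_form_unit[of "qs ! i" p]
      by (auto simp: take_map drop_map case_prod_beta)
  qed
  finally show ?case by simp
qed simp

section \<open>Words and monomials in the generators\<close>

definition e_word :: "(3 \<times> 3) list \<Rightarrow> sl3 uea" where
  "e_word ps = prod_list (map (\<lambda>(i, j). e_gen i j) ps)"

lemma e_word_simps [simp]:
  "e_word [] = 1" "e_word ((i, j) # ps) = e_gen i j * e_word ps"
  by (simp_all add: e_word_def)

lemma e_word_append: "e_word (ps @ qs) = e_word ps * e_word qs"
  by (simp add: e_word_def)

lemma e_word_eq: "e_word ps = uea_word (unit_word ps)"
  by (induction ps) (auto simp: e_word_def uea_word_def e_gen_def)

lemma uea_eval_e_word: "uea_eval (coord_forms qs) (e_word ps) = coord_forms qs (unit_word ps)"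
  by (simp add: e_word_eq uea_eval_word uea_form_coord_forms)

text \<open>No ordering of the letters is needed: all arrangements agree up to lower degree.\<close>

definition e_monom :: "(3 \<times> 3) multiset \<Rightarrow> sl3 uea" where
  "e_monom M = e_word (SOME ps. mset ps = M)"

definition pbw_monoms :: "(3 \<times> 3) multiset set" where
  "pbw_monoms = {M. (2, 2) \<notin># M}"

lemma e_monom_word: obtains ps where "mset ps = M" "e_monom M = e_word ps"
  using someI_ex[OF ex_mset[of M]] e_monom_def by metis

text \<open>The functional is \<open>coord_forms ms\<close> for a list \<open>ms\<close> of the
  letters of \<open>M\<close>: smaller monomials lie below its lowest degree, and those of equal
  size are separated by \<open>arrangements_pos_iff\<close>.\<close>

lemma e_monom_dual:
  assumes "M \<in> pbw_monoms"
  obtains \<phi> where "uea_form \<phi>" "uea_eval \<phi> (e_monom M) \<noteq> 0"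
    "\<And>N. N \<in> pbw_monoms \<Longrightarrow> size N \<le> size M \<Longrightarrow> N \<noteq> M \<Longrightarrow> uea_eval \<phi> (e_monom N) = 0"
proof -
  obtain ms where ms: "mset ms = M" by (meson ex_mset)
  have *: "uea_eval (coord_forms ms) (e_monom N) \<noteq> 0 \<longleftrightarrow> N = M"
    if N: "N \<in> pbw_monoms" "size N \<le> size M" for N
  proof -
    obtain ns where ns: "mset ns = N" "e_monom N = e_word ns" by (rule e_monom_word)
    show ?thesis
    proof (cases "size N = size M")
      case True
      then have "length ms = length ns" using ms ns by (metis size_mset)
      moreover have "(2, 2) \<notin> set ms" "(2, 2) \<notin> set ns"
        using ms ns assms N by (auto simp: pbw_monoms_def)
      ultimately show ?thesis
        using arrangements_pos_iff[of ms ns] ms ns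
        by (auto simp: uea_eval_e_word coord_forms_unit_word)
    next
      case False
      with N have "length ns < length ms" using ms ns by (metis le_neq_implies_less size_mset)
      then have "coord_forms ms (unit_word ns) = 0"
        using vanishes_below_coord_forms[of ms] by (simp add: vanishes_below_def)
      then show ?thesis using False by (auto simp: ns uea_eval_e_word)
    qed
  qed
  show ?thesis
    by (rule that[of "coord_forms ms"]) (use * assms in \<open>auto simp: uea_form_coord_forms\<close>)
qed

lemma e_monom_independent:
  assumes F: "finite F" "F \<subseteq> pbw_monoms" and 0: "(\<Sum>M\<in>F. uea_scale (c M) (e_monom M)) = 0"
    and N: "N \<in> F"
  shows "c N = 0"
proof (rule ccontr)
  assume "c N \<noteq> 0"
  \<comment> \<open>A monomial of maximal size among those with nonzero coefficient has a dual
    functional that kills every other term of the relation.\<close>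
  define G where "G = {M \<in> F. c M \<noteq> 0}"
  have "finite G" "G \<noteq> {}" using F N \<open>c N \<noteq> 0\<close> by (auto simp: G_def)
  then have "Max (size ` G) \<in> size ` G" by (intro Max_in) auto
  then obtain M where M: "M \<in> G" "size M = Max (size ` G)" by force
  then have max: "size L \<le> size M" if "L \<in> G" for L
    using \<open>finite G\<close> that by simp
  have "M \<in> pbw_monoms" using F M by (auto simp: G_def)
  from e_monom_dual[OF this] obtain \<phi> where \<phi>: "uea_eval \<phi> (e_monom M) \<noteq> 0"
    "\<And>N. N \<in> pbw_monoms \<Longrightarrow> size N \<le> size M \<Longrightarrow> N \<noteq> M \<Longrightarrow> uea_eval \<phi> (e_monom N) = 0"
    by metis
  have "0 = (\<Sum>L\<in>F. c L * uea_eval \<phi> (e_monom L))"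
    using arg_cong[OF 0, of "uea_eval \<phi>"] by (simp add: uea_eval_sum uea_eval_scale)
  also have "\<dots> = (\<Sum>L\<in>{M}. c L * uea_eval \<phi> (e_monom L))"
  proof (intro sum.mono_neutral_right ballI)
    fix L assume L: "L \<in> F - {M}"
    show "c L * uea_eval \<phi> (e_monom L) = 0"
    proof (cases "c L = 0")
      case False
      then have "size L \<le> size M" using L by (intro max) (simp add: G_def)
      with L F show ?thesis using \<phi>(2)[of L] by auto
    qed simp
  qed (use F M in \<open>auto simp: G_def\<close>)
  finally show False using M \<phi> by (simp add: G_def)
qed

lemma inj_on_e_monom: "inj_on e_monom pbw_monoms"
proof (rule inj_onI, rule ccontr)
  fix M N assume *: "M \<in> pbw_monoms" "N \<in> pbw_monoms" "e_monom M = e_monom N" "M \<noteq> N"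
  let ?c = "\<lambda>L. if L = M then 1 else - 1 :: complex"
  have "?c M = 0"
    by (rule e_monom_independent[of "{M, N}"]) (use * in auto)
  then show False by simp
qed

section \<open>Weights and the spanning monomials\<close>

text \<open>Out-degree minus in-degree at the vertex \<open>m\<close>, and also the eigenvalue of
  bracketing with \<open>e_gen m m\<close> from the left.\<close>

definition weight :: "(3 \<times> 3) multiset \<Rightarrow> 3 \<Rightarrow> int" where
  "weight M m = (\<Sum>(i, j)\<in>#M. of_bool (i = m) - of_bool (j = m))"

lemma weight_empty [simp]: "weight {#} = (\<lambda>_. 0)"
  and weight_add_mset: "weight (add_mset (i, j) M) m = of_bool (i = m) - of_bool (j = m) + weight M m"
  and weight_union: "weight (M + N) m = weight M m + weight N m"
  by (simp_all add: weight_def fun_eq_iff)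

text \<open>Correction terms are tracked by weight as well as by length, so that reordering a word
  of weight zero never leaves weight zero.\<close>

abbreviation lower_words :: "nat \<Rightarrow> (3 \<Rightarrow> int) \<Rightarrow> sl3 uea set" where
  "lower_words n \<mu> \<equiv> uea.span (e_word ` {ps. length ps < n \<and> weight (mset ps) = \<mu>})"

text \<open>The commutator of two generators is a combination of single generators of the same total
  weight, so one letter replaces two.\<close>

lemma e_word_swap:
  "e_word (us @ p # q # vs) - e_word (us @ q # p # vs) \<in>
     lower_words (length us + length vs + 2) (weight (mset (us @ p # q # vs)))"
    (is "_ \<in> ?W")
proof -
  obtain i j k l where [simp]: "p = (i, j)" "q = (k, l)" by fastforce
  have in_W: "(if P then e_word ws else 0) \<in> ?W"
    if "P \<Longrightarrow> length ws < length us + length vs + 2 \<and> weight (mset ws) = weight (mset (us @ p # q # vs))"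
    for P ws
    using that by (auto simp: uea.span_zero intro!: uea.span_base)
  have "e_word (us @ p # q # vs) - e_word (us @ q # p # vs) =
      e_word us * commutator (e_gen i j) (e_gen k l) * e_word vs"
    by (simp add: e_word_append commutator_def algebra_simps)
  also have "\<dots> = (if j = k then e_word (us @ (i, l) # vs) else 0)
      - (if l = i then e_word (us @ (k, j) # vs) else 0)"
    unfolding e_gen_commutator by (simp add: e_word_append algebra_simps)
  also have "\<dots> \<in> ?W"
    by (intro uea.span_diff in_W) (auto simp: weight_add_mset weight_union fun_eq_iff)
  finally show ?thesis .
qed

lemma e_word_move:
  "e_word (ws @ p # us @ vs) - e_word (ws @ us @ p # vs) \<in>
     lower_words (length ws + length us + length vs + 1) (weight (mset (ws @ p # us @ vs)))"
proof (induction us arbitrary: ws)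
  case Nil
  show ?case by (simp add: uea.span_zero)
next
  case (Cons q us)
  from Cons[of "ws @ [q]"] e_word_swap[of ws p q "us @ vs"]
  have "(e_word (ws @ p # q # us @ vs) - e_word (ws @ q # p # us @ vs)) +
      (e_word ((ws @ [q]) @ p # us @ vs) - e_word ((ws @ [q]) @ us @ p # vs)) \<in>
      lower_words (length ws + length (q # us) + length vs + 1) (weight (mset (ws @ p # (q # us) @ vs)))"
    by (intro uea.span_add) (simp_all add: add_mset_commute add_ac)
  then show ?case by simp
qed

lemma e_gen_mult_lower_words:
  assumes "x \<in> lower_words n \<mu>"
  shows "e_gen i j * x \<in> lower_words (Suc n) (\<lambda>m. of_bool (i = m) - of_bool (j = m) + \<mu> m)"
  using assms
proof (induction rule: uea.span_induct_alt)
  case base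
  show ?case by (simp add: uea.span_zero)
next
  case (step c x y)
  then obtain ps where ps: "x = e_word ps" "length ps < n" "weight (mset ps) = \<mu>" by auto
  then have "e_word ((i, j) # ps) \<in> lower_words (Suc n) (\<lambda>m. of_bool (i = m) - of_bool (j = m) + \<mu> m)"
    by (intro uea.span_base imageI) (auto simp: weight_add_mset fun_eq_iff)
  then have "e_gen i j * x \<in> lower_words (Suc n) (\<lambda>m. of_bool (i = m) - of_bool (j = m) + \<mu> m)"
    by (simp add: ps)
  with step show ?case
    by (simp add: distrib_left uea_scale_mult_right uea.span_add uea.span_scale)
qed

text \<open>The first letter \<open>p\<close> of \<open>ps\<close> is located in \<open>qs\<close>.
  The induction hypothesis, multiplied by \<open>p\<close> from the left, orders the remaining
  letters, and \<open>e_word_move\<close> brings \<open>p\<close> to its place.\<close>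

lemma e_word_reorder:
  "mset ps = mset qs \<Longrightarrow> e_word ps - e_word qs \<in> lower_words (length ps) (weight (mset ps))"
proof (induction ps arbitrary: qs)
  case Nil
  then show ?case by (simp add: uea.span_zero)
next
  case (Cons p ps)
  then have "p \<in> set qs" by (metis list.set_intros(1) set_mset_mset)
  then obtain us vs where qs: "qs = us @ p # vs" by (metis split_list)
  obtain i j where p: "p = (i, j)" by fastforce
  have m: "mset ps = mset (us @ vs)" using Cons.prems qs by simp
  then have len: "length ps = length us + length vs" by (metis length_append size_mset)
  have "e_gen i j * (e_word ps - e_word (us @ vs)) \<in> lower_words (length (p # ps)) (weight (mset (p # ps)))"
    using e_gen_mult_lower_words[OF Cons.IH[OF m], of i j]
    by (simp add: p weight_add_mset fun_eq_iff flip: weight_add_mset)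
  moreover have "e_word (p # us @ vs) - e_word (us @ p # vs) \<in>
      lower_words (length (p # ps)) (weight (mset (p # ps)))"
    using e_word_move[of "[]" p us vs] m len by simp
  ultimately have "e_gen i j * (e_word ps - e_word (us @ vs)) + (e_word (p # us @ vs) - e_word (us @ p # vs))
      \<in> lower_words (length (p # ps)) (weight (mset (p # ps)))"
    by (rule uea.span_add)
  then show ?case by (simp add: p qs algebra_simps)
qed

section \<open>Elimination of \<open>e_gen 2 2\<close> and the spanning monomials\<close>

lemma uea_incl_zero [simp]: "uea_incl 0 = 0"
  using uea_incl_add[of 0 0] by simp

lemma e_gen_trace: "e_gen 1 1 + e_gen 2 2 + e_gen 3 3 = 0"
proof -
  have "sl3_unit 1 1 + sl3_unit 2 2 + sl3_unit 3 3 = 0"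
    by (simp add: mat_of_sl3_inject[symmetric] plus_sl3.rep_eq zero_sl3.rep_eq vec_eq_iff
        sl3_unit_nth forall_3)
  then show ?thesis by (simp add: e_gen_def flip: uea_incl_add)
qed

lemma e_gen_2_2: "e_gen 2 2 = - e_gen 1 1 - e_gen 3 3"
  using e_gen_trace by (simp add: algebra_simps eq_neg_iff_add_eq_0)

text \<open>All diagonal letters have weight zero, so replacing \<open>e_gen 2 2\<close> by the
  other two changes neither length nor weight.\<close>

lemma e_word_eliminate:
  "e_word ps \<in> uea.span (e_word ` {qs. length qs = length ps \<and> weight (mset qs) = weight (mset ps)
     \<and> (2, 2) \<notin> set qs})"
proof (induction ps)
  case Nil
  show ?case by (intro uea.span_base) (auto intro!: image_eqI[of _ _ "[]"])
next
  case (Cons p ps)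
  let ?S = "\<lambda>ps. uea.span (e_word ` {qs. length qs = length ps \<and> weight (mset qs) = weight (mset ps)
     \<and> (2, 2) \<notin> set qs})"
  obtain i j where p: "p = (i, j)" by fastforce
  \<comment> \<open>Covers both uses: the letter is kept, or a diagonal letter is replaced by
    another one.\<close>
  have *: "e_gen k l * x \<in> ?S (p # ps)"
    if "(k, l) \<noteq> (2, 2)" "(k, l) = (i, j) \<or> k = l \<and> i = j" "x \<in> ?S ps" for k l x
    using that(3)
  proof (induction rule: uea.span_induct_alt)
    case base
    show ?case by (simp add: uea.span_zero)
  next
    case (step c x y)
    then obtain qs where qs: "x = e_word qs" "length qs = length ps"
      "weight (mset qs) = weight (mset ps)" "(2, 2) \<notin> set qs" by auto
    then have "e_word ((k, l) # qs) \<in> ?S (p # ps)"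
      using that(1,2) by (intro uea.span_base imageI) (auto simp: p weight_add_mset fun_eq_iff)
    then have "e_gen k l * x \<in> ?S (p # ps)"
      by (simp add: qs)
    with step show ?case
      by (simp add: distrib_left uea_scale_mult_right uea.span_add uea.span_scale)
  qed
  show ?case
  proof (cases "p = (2, 2)")
    case True
    have "- (e_gen 1 1 * e_word ps) - e_gen 3 3 * e_word ps \<in> ?S (p # ps)"
      using True p Cons by (intro uea.span_diff uea.span_neg *) auto
    then show ?thesis by (simp add: True e_gen_2_2 algebra_simps)
  next
    case False
    then show ?thesis using *[of i j "e_word ps"] Cons by (simp add: p)
  qed
qed

text \<open>The spanning half of a Poincare-Birkhoff-Witt theorem, refined by weight; reordering
  errors are shorter words, handled by induction on the length.\<close>

lemma e_word_pbw_span: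
  "e_word ps \<in> uea.span (e_monom ` {M \<in> pbw_monoms. size M \<le> length ps \<and> weight M = weight (mset ps)})"
proof (induction "length ps" arbitrary: ps rule: less_induct)
  case less
  let ?S = "uea.span (e_monom ` {M \<in> pbw_monoms. size M \<le> length ps \<and> weight M = weight (mset ps)})"
  have lower: "x \<in> ?S" if "x \<in> lower_words (length ps) (weight (mset ps))" for x
  proof -
    have "e_word qs \<in> ?S" if "length qs < length ps" "weight (mset qs) = weight (mset ps)" for qs
      using less[of qs] that by (rule_tac set_mp[OF uea.span_mono]) auto
    then have "lower_words (length ps) (weight (mset ps)) \<subseteq> ?S"
      by (intro uea.span_minimal) auto
    with that show ?thesis by blast
  qed
  have "e_word qs \<in> ?S"
    if qs: "length qs = length ps" "weight (mset qs) = weight (mset ps)" "(2, 2) \<notin> set qs" for qs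
  proof -
    obtain rs where rs: "mset rs = mset qs" "e_monom (mset qs) = e_word rs" by (rule e_monom_word)
    have "e_word qs - e_word rs \<in> ?S"
      using e_word_reorder[of qs rs] rs qs by (intro lower) simp
    moreover have "e_word rs \<in> ?S"
      using qs by (intro uea.span_base) (auto simp: pbw_monoms_def simp flip: rs(2) intro!: imageI)
    ultimately show ?thesis using uea.span_add by fastforce
  qed
  then have "uea.span (e_word ` {qs. length qs = length ps \<and> weight (mset qs) = weight (mset ps)
     \<and> (2, 2) \<notin> set qs}) \<subseteq> ?S"
    by (intro uea.span_minimal) auto
  with e_word_eliminate show ?case by blast
qed

section \<open>The filtration and its exhaustiveness\<close>

lemma sl3_filtration_eq_e_word: "sl3_filtration k = uea.span (e_word ` {ps. length ps \<le> k})"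
  by (simp add: sl3_filtration_def e_word_def[abs_def] setcompr_eq_image)

lemma sl3_filtration_eq: "sl3_filtration k = uea.span (e_monom ` {M \<in> pbw_monoms. size M \<le> k})"
proof
  show "sl3_filtration k \<subseteq> uea.span (e_monom ` {M \<in> pbw_monoms. size M \<le> k})"
    unfolding sl3_filtration_eq_e_word
  proof (intro uea.span_minimal, clarsimp)
    fix ps :: "(3 \<times> 3) list" assume "length ps \<le> k"
    then show "e_word ps \<in> uea.span (e_monom ` {M \<in> pbw_monoms. size M \<le> k})"
      by (intro set_mp[OF uea.span_mono e_word_pbw_span[of ps]]) auto
  qed simp
  show "uea.span (e_monom ` {M \<in> pbw_monoms. size M \<le> k}) \<subseteq> sl3_filtration k"
    unfolding sl3_filtration_eq_e_word
  proof (intro uea.span_mono, clarify)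
    fix M :: "(3 \<times> 3) multiset" assume "size M \<le> k"
    moreover obtain ps where "mset ps = M" "e_monom M = e_word ps" by (rule e_monom_word)
    ultimately show "e_monom M \<in> e_word ` {ps. length ps \<le> k}" by auto
  qed
qed

text \<open>The multiples of the identity subtracted in the diagonal units add up to a third of the
  trace of \<open>x\<close>, which is 0.\<close>

lemma sl3_eq_sum_units: "x = (\<Sum>i\<in>UNIV. \<Sum>j\<in>UNIV. cscale (mat_of_sl3 x $ i $ j) (sl3_unit i j))"
proof -
  have "mat_of_sl3 x $ 1 $ 1 + mat_of_sl3 x $ 2 $ 2 + mat_of_sl3 x $ 3 $ 3 = 0"
    using mat_of_sl3[of x] by (simp add: trace_def sum_3)
  then show ?thesis
    by (simp add: mat_of_sl3_inject[symmetric] sum_3 plus_sl3.rep_eq cscale_sl3.rep_eq vec_eq_iff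
        sl3_unit_nth forall_3 field_simps)
qed

lemma uea_incl_eq_sum:
  "uea_incl x = (\<Sum>i\<in>UNIV. \<Sum>j\<in>UNIV. uea_scale (mat_of_sl3 x $ i $ j) (e_gen i j))"
  by (subst sl3_eq_sum_units[of x]) (simp add: sum_3 uea_incl_add uea_incl_cscale e_gen_def)

lemma e_gen_mult_filtration:
  assumes "x \<in> sl3_filtration k"
  shows "e_gen i j * x \<in> sl3_filtration (Suc k)"
  using assms unfolding sl3_filtration_eq_e_word
proof (induction rule: uea.span_induct_alt)
  case base
  show ?case by (simp add: uea.span_zero)
next
  case (step c x y)
  then obtain ps where ps: "x = e_word ps" "length ps \<le> k" by auto
  then have "e_word ((i, j) # ps) \<in> uea.span (e_word ` {ps. length ps \<le> Suc k})"
    by (intro uea.span_base imageI) auto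
  then have "e_gen i j * x \<in> uea.span (e_word ` {ps. length ps \<le> Suc k})" by (simp add: ps)
  with step show ?case
    by (simp add: distrib_left uea_scale_mult_right uea.span_add uea.span_scale)
qed

lemma uea_word_filtration: "uea_word xs \<in> sl3_filtration (length xs)"
proof (induction xs)
  case Nil
  have "e_word [] \<in> sl3_filtration 0"
    unfolding sl3_filtration_eq_e_word by (intro uea.span_base imageI) simp
  then show ?case by (simp add: uea_word_def)
next
  case (Cons x xs)
  have "uea_incl x * y \<in> sl3_filtration (Suc k)" if "y \<in> sl3_filtration k" for y k
    using e_gen_mult_filtration[OF that]
    by (simp add: uea_incl_eq_sum sum_distrib_right uea_scale_mult_left sl3_filtration_def
        uea.span_sum uea.span_scale)
  with Cons show ?case by (simp add: uea_word_def)
qed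

lemma sl3_filtration_mono: "k \<le> l \<Longrightarrow> sl3_filtration k \<subseteq> sl3_filtration l"
  unfolding sl3_filtration_eq_e_word by (intro uea.span_mono) auto

text \<open>The enveloping algebra is spanned by words in arbitrary elements of \<open>sl3\<close>,
  whereas the filtration uses only the \<open>e_gen i j\<close>; each letter is expanded in
  these.\<close>

lemma sl3_filtration_exhaustive: obtains k where "x \<in> sl3_filtration k"
proof -
  have "\<exists>k. x \<in> sl3_filtration k"
    using uea_word_span[of x]
  proof (induction rule: uea.span_induct_alt)
    case base
    show ?case by (auto simp: sl3_filtration_def uea.span_zero)
  next
    case (step c x y)
    then obtain xs k where *: "x = uea_word xs" "y \<in> sl3_filtration k" by auto
    have "uea_scale c x + y \<in> sl3_filtration (max (length xs) k)"
      using * uea_word_filtration[of xs]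
        sl3_filtration_mono[of "length xs" "max (length xs) k"] sl3_filtration_mono[of k "max (length xs) k"]
      unfolding sl3_filtration_def by (intro uea.span_add uea.span_scale) auto
    then show ?case by blast
  qed
  then show ?thesis using that by blast
qed

section \<open>The centralizer and its graded dimensions\<close>

lemma commutator_mult_left: "commutator (x * y) z = x * commutator y z + commutator x z * (y :: 'r :: ring)"
  by (simp add: commutator_def algebra_simps)

lemma commutator_add:
  "commutator (x + y) z = commutator x z + commutator (y :: 'r :: ring) z"
  "commutator z (x + y) = commutator z x + commutator z y"
  by (simp_all add: commutator_def algebra_simps)

lemma commutator_diff: "commutator z (x - y) = commutator z x - commutator z (y :: 'r :: ring)"
  by (simp add: commutator_def algebra_simps)

lemma commutator_zero [simp]:
  "commutator 0 x = 0" "commutator x 0 = 0" for x :: "'r :: ring"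
  by (simp_all add: commutator_def)

lemma commutator_scale:
  "commutator (uea_scale c x) y = uea_scale c (commutator x y)"
  "commutator x (uea_scale c y) = uea_scale c (commutator x y)"
  by (simp_all add: commutator_def uea_scale_mult_left uea_scale_mult_right uea.scale_right_diff_distrib)

lemma e_word_commutator:
  "commutator (e_word ps) (e_gen m m) = uea_scale (- of_int (weight (mset ps) m)) (e_word ps)"
proof (induction ps)
  case Nil
  show ?case by (simp add: commutator_def)
next
  case (Cons p ps)
  obtain i j where p: "p = (i, j)" by fastforce
  have "commutator (e_gen i j) (e_gen m m) = uea_scale (of_bool (j = m) - of_bool (i = m)) (e_gen i j)"
    by (auto simp: e_gen_commutator)
  then show ?case using Cons
    by (simp add: p commutator_mult_left weight_add_mset uea_scale_mult_left uea_scale_mult_right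
        uea.scale_left_distrib uea.scale_left_diff_distrib)
qed

lemma e_monom_commutator:
  "commutator (e_monom M) (e_gen m m) = uea_scale (- of_int (weight M m)) (e_monom M)"
  by (metis e_monom_word e_word_commutator)

text \<open>Commuting with \<open>H1\<close> and \<open>H2\<close> makes the three commutators with
  the \<open>e_gen m m\<close> equal; their sum is 0 by \<open>e_gen_trace\<close>, and 3 is
  invertible.\<close>

lemma cartan_centralizer_iff: "x \<in> cartan_centralizer \<longleftrightarrow> (\<forall>m. commutator x (e_gen m m) = 0)"
proof
  assume "x \<in> cartan_centralizer"
  then have "commutator x (e_gen 1 1) = commutator x (e_gen 2 2)"
    "commutator x (e_gen 2 2) = commutator x (e_gen 3 3)"
    by (simp_all add: cartan_centralizer_def H1_def H2_def commutator_scale commutator_diff)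
  moreover have "commutator x (e_gen 1 1) + commutator x (e_gen 2 2) + commutator x (e_gen 3 3) = 0"
    by (simp add: e_gen_trace flip: commutator_add)
  ultimately have 3: "commutator x (e_gen 3 3) + commutator x (e_gen 3 3) + commutator x (e_gen 3 3) = 0"
    by simp
  have "uea_scale 3 y = y + y + y" for y :: "sl3 uea"
    using uea.scale_left_distrib[of 2 1 y] uea.scale_left_distrib[of 1 1 y] by simp
  with 3 have "uea_scale 3 (commutator x (e_gen 3 3)) = 0" by simp
  then have "commutator x (e_gen 3 3) = 0" by simp
  with \<open>commutator x (e_gen 1 1) = _\<close> \<open>commutator x (e_gen 2 2) = _\<close>
  show "\<forall>m. commutator x (e_gen m m) = 0" by (simp add: forall_3)
qed (simp add: cartan_centralizer_def H1_def H2_def commutator_scale commutator_diff)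

definition zero_monoms :: "nat \<Rightarrow> (3 \<times> 3) multiset set" where
  "zero_monoms k = {M \<in> pbw_monoms. size M \<le> k \<and> weight M = (\<lambda>_. 0)}"

lemma in_span_e_monomE:
  assumes "x \<in> uea.span (e_monom ` A)"
  obtains F c where "finite F" "F \<subseteq> A" "x = (\<Sum>M\<in>F. uea_scale (c M) (e_monom M))"
proof -
  obtain t r where t: "finite t" "t \<subseteq> e_monom ` A" "x = (\<Sum>a\<in>t. uea_scale (r a) a)"
    using assms unfolding uea.span_explicit by blast
  then obtain F where F: "F \<subseteq> A" "inj_on e_monom F" "t = e_monom ` F"
    by (meson subset_image_inj)
  show ?thesis
    by (rule that[of F "\<lambda>M. r (e_monom M)"])
       (use t F in \<open>auto simp: sum.reindex dest: finite_imageD\<close>)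
qed

lemma commutator_sum_left:
  "commutator (\<Sum>i\<in>I. f i) z = (\<Sum>i\<in>I. commutator (f i) (z :: 'r :: ring))"
  by (induction I rule: infinite_finite_induct) (simp_all add: commutator_add)

lemma subspace_cartan_centralizer: "uea.subspace cartan_centralizer"
  by (rule uea.subspaceI) (auto simp: cartan_centralizer_def commutator_add commutator_scale)

text \<open>The monomials are linearly independent eigenvectors: taking the commutator with
  \<open>e_gen m m\<close> multiplies each coefficient by an eigenvalue, so a nonzero coefficient
  forces weight zero.\<close>

lemma cartan_centralizer_filtration:
  "cartan_centralizer \<inter> sl3_filtration k = uea.span (e_monom ` zero_monoms k)"
proof
  show "uea.span (e_monom ` zero_monoms k) \<subseteq> cartan_centralizer \<inter> sl3_filtration k"
  proof (intro Int_greatest uea.span_minimal subspace_cartan_centralizer)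
    show "e_monom ` zero_monoms k \<subseteq> cartan_centralizer"
      by (auto simp: cartan_centralizer_iff e_monom_commutator zero_monoms_def)
    show "e_monom ` zero_monoms k \<subseteq> sl3_filtration k"
      unfolding sl3_filtration_eq zero_monoms_def by (auto intro!: uea.span_base)
    show "uea.subspace (sl3_filtration k)" by (simp add: sl3_filtration_def)
  qed
next
  show "cartan_centralizer \<inter> sl3_filtration k \<subseteq> uea.span (e_monom ` zero_monoms k)"
  proof
    fix x assume x: "x \<in> cartan_centralizer \<inter> sl3_filtration k"
    then have "x \<in> uea.span (e_monom ` {M \<in> pbw_monoms. size M \<le> k})" by (simp add: sl3_filtration_eq)
    then obtain F c where F: "finite F" "F \<subseteq> {M \<in> pbw_monoms. size M \<le> k}"
      and eq: "x = (\<Sum>M\<in>F. uea_scale (c M) (e_monom M))" by (rule in_span_e_monomE)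
    have "c M * - of_int (weight M m) = 0" if "M \<in> F" for M m
    proof (rule e_monom_independent[of F])
      have "commutator x (e_gen m m) = 0" using x by (simp add: cartan_centralizer_iff)
      then show "(\<Sum>M\<in>F. uea_scale (c M * - of_int (weight M m)) (e_monom M)) = 0"
        by (simp add: eq commutator_sum_left commutator_scale e_monom_commutator)
    qed (use F that in auto)
    then have *: "c M = 0 \<or> M \<in> zero_monoms k" if "M \<in> F" for M
      using that F by (auto simp: zero_monoms_def fun_eq_iff)
    show "x \<in> uea.span (e_monom ` zero_monoms k)"
      unfolding eq
    proof (intro uea.span_sum)
      fix M assume "M \<in> F"
      with * show "uea_scale (c M) (e_monom M) \<in> uea.span (e_monom ` zero_monoms k)"
        by (metis imageI uea.scale_zero_left uea.span_base uea.span_scale uea.span_zero)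
    qed
  qed
qed

text \<open>Since \<open>quotient_dim\<close> chooses a basis, every basis \<open>B'\<close> of the
  quotient must have the size of \<open>B\<close>. Adding \<open>C\<close> to both gives two bases
  of \<open>V\<close>, which have equal size by the exchange lemma.\<close>

lemma quotient_dim_eq_card:
  assumes V: "V = uea.span (B \<union> C)" and W: "W = uea.span C"
    and fin: "finite (B \<union> C)" and ind: "uea.independent (B \<union> C)" and disj: "B \<inter> C = {}"
  shows "quotient_dim V W = card B"
proof -
  have "basis_mod W V B"
    unfolding basis_mod_def
  proof (intro conjI allI impI ballI)
    show "B \<subseteq> V" using uea.span_superset[of "B \<union> C"] by (auto simp: V)
  next
    fix F c b assume F: "finite F \<and> F \<subseteq> B \<and> (\<Sum>b\<in>F. uea_scale (c b) b) \<in> W" and b: "b \<in> F"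
    then obtain d where d: "(\<Sum>b\<in>F. uea_scale (c b) b) = (\<Sum>x\<in>C. uea_scale (d x) x)"
      using fin unfolding W by (auto simp: uea.span_finite)
    let ?u = "\<lambda>x. if x \<in> F then c x else - d x"
    have "(\<Sum>x\<in>F \<union> C. uea_scale (?u x) x) = (\<Sum>x\<in>F. uea_scale (?u x) x) + (\<Sum>x\<in>C. uea_scale (?u x) x)"
      using F fin disj by (intro sum.union_disjoint) auto
    also have "(\<Sum>x\<in>C. uea_scale (?u x) x) = (\<Sum>x\<in>C. - uea_scale (d x) x)"
      using F disj by (intro sum.cong) auto
    finally have "(\<Sum>x\<in>F \<union> C. uea_scale (?u x) x) = 0"
      by (simp add: sum_negf d)
    with F fin b have "?u b = 0"
      by (intro uea.independentD[OF ind, of "F \<union> C"]) auto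
    with b show "c b = 0" by simp
  next
    fix v assume "v \<in> V"
    then obtain x y where xy: "v = x + y" "x \<in> uea.span B" "y \<in> uea.span C"
      unfolding V uea.span_Un by auto
    then obtain c where "x = (\<Sum>b\<in>B. uea_scale (c b) b)" using fin by (auto simp: uea.span_finite)
    with xy fin show "\<exists>F c. finite F \<and> F \<subseteq> B \<and> v - (\<Sum>b\<in>F. uea_scale (c b) b) \<in> W"
      by (intro exI[of _ B] exI[of _ c]) (auto simp: W)
  qed
  moreover have "card B' = card B" if B': "basis_mod W V B'" for B'
  proof -
    have sub: "B' \<subseteq> V"
      and coeff: "\<And>F c b. finite F \<Longrightarrow> F \<subseteq> B' \<Longrightarrow> (\<Sum>b\<in>F. uea_scale (c b) b) \<in> W \<Longrightarrow> b \<in> F \<Longrightarrow> c b = 0"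
      and gen: "\<And>v. v \<in> V \<Longrightarrow> \<exists>F c. finite F \<and> F \<subseteq> B' \<and> v - (\<Sum>b\<in>F. uea_scale (c b) b) \<in> W"
      using B' unfolding basis_mod_def by blast+
    have disj': "B' \<inter> C = {}"
    proof (rule ccontr)
      assume "B' \<inter> C \<noteq> {}"
      then obtain b where "b \<in> B'" "b \<in> C" by blast
      then have "(1::complex) = 0"
        by (intro coeff[of "{b}" "\<lambda>_. 1" b]) (simp_all add: W uea.span_base)
      then show False by simp
    qed
    \<comment> \<open>The part of a relation over \<open>B'\<close> lies in \<open>W\<close>, so its
      coefficients vanish; what remains is a relation over \<open>C\<close>.\<close>
    have ind': "uea.independent (B' \<union> C)"
      unfolding uea.independent_explicit_module
    proof (intro allI impI)
      fix t u v assume t: "finite t" "t \<subseteq> B' \<union> C" and 0: "(\<Sum>v\<in>t. uea_scale (u v) v) = 0" and v: "v \<in> t"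
      have "t = (t \<inter> B') \<union> (t \<inter> C)" using t by blast
      then have "(\<Sum>v\<in>t. uea_scale (u v) v) =
          (\<Sum>v\<in>t \<inter> B'. uea_scale (u v) v) + (\<Sum>v\<in>t \<inter> C. uea_scale (u v) v)"
        using sum.union_disjoint[of "t \<inter> B'" "t \<inter> C" "\<lambda>v. uea_scale (u v) v"] t disj' by auto
      with 0 have neg: "(\<Sum>v\<in>t \<inter> B'. uea_scale (u v) v) = - (\<Sum>v\<in>t \<inter> C. uea_scale (u v) v)"
        by (simp add: eq_neg_iff_add_eq_0)
      then have "(\<Sum>v\<in>t \<inter> B'. uea_scale (u v) v) \<in> W"
        unfolding W neg by (intro uea.span_neg uea.span_sum uea.span_scale uea.span_base) blast
      then have B0: "u b = 0" if "b \<in> t \<inter> B'" for b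
        using coeff[of "t \<inter> B'" u b] t that by auto
      then have "(\<Sum>v\<in>t \<inter> C. uea_scale (u v) v) = 0" using neg by simp
      then have "u b = 0" if "b \<in> t \<inter> C" for b
        using t that by (intro uea.independentD[OF ind, of "t \<inter> C"]) auto
      with B0 v t show "u v = 0" by blast
    qed
    have spn: "B \<union> C \<subseteq> uea.span (B' \<union> C)"
    proof
      fix v assume "v \<in> B \<union> C"
      then have "v \<in> V" by (simp add: V uea.span_base)
      then obtain F c where F: "finite F" "F \<subseteq> B'" "v - (\<Sum>b\<in>F. uea_scale (c b) b) \<in> W"
        using gen by blast
      have "v - (\<Sum>b\<in>F. uea_scale (c b) b) \<in> uea.span (B' \<union> C)"
        using F uea.span_mono[of C "B' \<union> C"] by (auto simp: W)
      moreover have "(\<Sum>b\<in>F. uea_scale (c b) b) \<in> uea.span (B' \<union> C)"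
        using F by (intro uea.span_sum uea.span_scale uea.span_base) blast
      ultimately show "v \<in> uea.span (B' \<union> C)" using uea.span_add by fastforce
    qed
    have "B' \<union> C \<subseteq> uea.span (B \<union> C)"
      using sub uea.span_superset[of "B \<union> C"] by (auto simp: V)
    then have 1: "finite (B' \<union> C)" "card (B' \<union> C) \<le> card (B \<union> C)"
      using uea.independent_span_bound[OF fin ind'] by auto
    with uea.independent_span_bound[OF 1(1) ind spn] have "card (B' \<union> C) = card (B \<union> C)" by simp
    with 1 fin disj disj' show ?thesis by (simp add: card_Un_disjoint)
  qed
  ultimately show ?thesis unfolding quotient_dim_def by (metis someI)
qed

lemma independent_e_monom: "A \<subseteq> pbw_monoms \<Longrightarrow> uea.independent (e_monom ` A)"
  unfolding uea.independent_explicit_module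
proof (intro allI impI)
  fix t u v assume A: "A \<subseteq> pbw_monoms" and t: "finite t" "t \<subseteq> e_monom ` A"
    and 0: "(\<Sum>v\<in>t. uea_scale (u v) v) = 0" and v: "v \<in> t"
  then obtain F where F: "F \<subseteq> A" "inj_on e_monom F" "t = e_monom ` F"
    by (meson subset_image_inj)
  from v F obtain M where M: "M \<in> F" "v = e_monom M" by blast
  have "u (e_monom M) = 0"
    by (rule e_monom_independent[of F "\<lambda>M. u (e_monom M)"])
       (use A t 0 F M in \<open>auto simp: sum.reindex dest: finite_imageD\<close>)
  with M show "u v = 0" by simp
qed

lemma finite_zero_monoms: "finite (zero_monoms k)"
proof (rule finite_subset)
  show "zero_monoms k \<subseteq> mset ` {ps. set ps \<subseteq> UNIV \<and> length ps \<le> k}"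
    by (auto simp: zero_monoms_def) (metis (mono_tags) ex_mset image_eqI mem_Collect_eq size_mset)
qed (intro finite_imageI finite_lists_length_le, simp)

lemma hilbert_series_cartan_centralizer:
  "hilbert_series cartan_centralizer =
     Abs_fps (\<lambda>k. of_nat (card {M \<in> pbw_monoms. weight M = (\<lambda>_. 0) \<and> size M = k}))"
proof -
  let ?Z = "\<lambda>k. {M \<in> pbw_monoms. weight M = (\<lambda>_. 0) \<and> size M = k}"
  have "quotient_dim (cartan_centralizer \<inter> sl3_filtration k)
      (if k = 0 then {0} else cartan_centralizer \<inter> sl3_filtration (k - 1)) = card (?Z k)" for k
  proof -
    \<comment> \<open>For \<open>k = 0\<close> this must be empty, since \<open>k - 1\<close>
      truncates to 0; the span is then \<open>{0}\<close>.\<close>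
    define C where "C = (if k = 0 then {} else zero_monoms (k - 1))"
    have un: "?Z k \<union> C = zero_monoms k" and disj: "?Z k \<inter> C = {}" and pbw: "zero_monoms k \<subseteq> pbw_monoms"
      by (auto simp: C_def zero_monoms_def)
    have inj: "inj_on e_monom (?Z k \<union> C)"
      using pbw inj_on_subset[OF inj_on_e_monom] by (simp add: un)
    have im: "e_monom ` ?Z k \<union> e_monom ` C = e_monom ` zero_monoms k"
      by (simp only: un flip: image_Un)
    have "quotient_dim (cartan_centralizer \<inter> sl3_filtration k)
        (if k = 0 then {0} else cartan_centralizer \<inter> sl3_filtration (k - 1)) = card (e_monom ` ?Z k)"
    proof (rule quotient_dim_eq_card[where C = "e_monom ` C"])
      show "cartan_centralizer \<inter> sl3_filtration k = uea.span (e_monom ` ?Z k \<union> e_monom ` C)"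
        by (simp only: cartan_centralizer_filtration im)
      show "(if k = 0 then {0} else cartan_centralizer \<inter> sl3_filtration (k - 1)) = uea.span (e_monom ` C)"
        by (simp add: cartan_centralizer_filtration C_def)
      show "finite (e_monom ` ?Z k \<union> e_monom ` C)"
        unfolding im by (intro finite_imageI finite_zero_monoms)
      show "uea.independent (e_monom ` ?Z k \<union> e_monom ` C)"
        unfolding im by (rule independent_e_monom[OF pbw])
      show "e_monom ` ?Z k \<inter> e_monom ` C = {}"
        using inj disj by (simp add: inj_on_image_Int[of _ "?Z k \<union> C", symmetric])
    qed
    also have "\<dots> = card (?Z k)"
      using inj by (intro card_image) (auto intro: inj_on_subset)
    finally show ?thesis .
  qed
  then show ?thesis by (simp add: hilbert_series_def)
qed

section \<open>Generators of the centralizer\<close>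

lemma subalgebra_hull: "subalgebra (subalgebra hull S)"
proof (rule hull_in)
  fix \<A> :: "'a uea set set" assume "Ball \<A> subalgebra"
  then show "subalgebra (\<Inter>\<A>)"
    unfolding subalgebra_def by (auto intro!: uea.subspace_Inter)
qed

lemma subalgebra_closed:
  assumes "subalgebra A"
  shows "0 \<in> A" "1 \<in> A" "x \<in> A \<Longrightarrow> y \<in> A \<Longrightarrow> x + y \<in> A" "x \<in> A \<Longrightarrow> y \<in> A \<Longrightarrow> x - y \<in> A"
    "x \<in> A \<Longrightarrow> uea_scale c x \<in> A" "x \<in> A \<Longrightarrow> y \<in> A \<Longrightarrow> x * y \<in> A" "x \<in> A \<Longrightarrow> x ^ n \<in> A"
    "2 \<in> A" "(\<And>i. i \<in> I \<Longrightarrow> f i \<in> A) \<Longrightarrow> (\<Sum>i\<in>I. f i) \<in> A"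
proof -
  have s: "uea.subspace A" using assms by (simp add: subalgebra_def)
  show "0 \<in> A" "1 \<in> A" "x \<in> A \<Longrightarrow> y \<in> A \<Longrightarrow> x + y \<in> A" "x \<in> A \<Longrightarrow> y \<in> A \<Longrightarrow> x - y \<in> A"
    "x \<in> A \<Longrightarrow> uea_scale c x \<in> A" "(\<And>i. i \<in> I \<Longrightarrow> f i \<in> A) \<Longrightarrow> (\<Sum>i\<in>I. f i) \<in> A"
    using assms s
    by (auto simp: subalgebra_def uea.subspace_0 uea.subspace_add uea.subspace_diff
        uea.subspace_scale uea.subspace_sum)
  show m: "x \<in> A \<Longrightarrow> y \<in> A \<Longrightarrow> x * y \<in> A" for x y using assms by (simp add: subalgebra_def)
  show "x \<in> A \<Longrightarrow> x ^ n \<in> A"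
    using assms by (induction n) (auto simp: subalgebra_def m)
  show "2 \<in> A"
    using assms s uea.subspace_add[of A 1 1] by (simp add: subalgebra_def)
qed

lemma subalgebra_cartan_centralizer: "subalgebra cartan_centralizer"
  using subspace_cartan_centralizer
  by (auto simp: subalgebra_def cartan_centralizer_def commutator_mult_left)
     (simp_all add: commutator_def)

lemma e_word_cartan_centralizer: "weight (mset ps) = (\<lambda>_. 0) \<Longrightarrow> e_word ps \<in> cartan_centralizer"
  by (simp add: cartan_centralizer_iff e_word_commutator)

text \<open>All seven are built from closed walks of length at most 3, which have weight
  zero.\<close>

lemma generators_cartan_centralizer:
  "{J_elt, Jbar_elt, K_elt, H1, H2, C2, C3} \<subseteq> cartan_centralizer"
proof -
  note closed = subalgebra_closed[OF subalgebra_cartan_centralizer]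
  have 1: "e_gen i i \<in> cartan_centralizer" for i
    using e_word_cartan_centralizer[of "[(i, i)]"] by (simp add: weight_add_mset fun_eq_iff)
  have 2: "e_gen i j * e_gen j i \<in> cartan_centralizer" for i j
    using e_word_cartan_centralizer[of "[(i, j), (j, i)]"] by (simp add: weight_add_mset fun_eq_iff)
  have 3: "e_gen i j * e_gen j k * e_gen k i \<in> cartan_centralizer" for i j k
    using e_word_cartan_centralizer[of "[(i, j), (j, k), (k, i)]"]
    by (simp add: weight_add_mset fun_eq_iff mult.assoc)
  have J: "J_elt \<in> cartan_centralizer" "Jbar_elt \<in> cartan_centralizer"
    unfolding J_elt_def Jbar_elt_def by (intro closed 1 2)+
  moreover have "K_elt \<in> cartan_centralizer"
    unfolding K_elt_def commutator_def by (intro closed J)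
  moreover have "H1 \<in> cartan_centralizer" "H2 \<in> cartan_centralizer"
    unfolding H1_def H2_def by (intro closed 1)+
  moreover have "C2 \<in> cartan_centralizer" "C3 \<in> cartan_centralizer"
    unfolding C2_def C3_def by (intro closed 2 3)+
  ultimately show ?thesis by blast
qed

section \<open>Cycles in balanced multigraphs\<close>

lemma weight_eq_counts:
  "weight M m = (\<Sum>j\<in>UNIV. int (count M (m, j))) - (\<Sum>i\<in>UNIV. int (count M (i, m)))"
proof (induction M)
  case (add p M)
  obtain i j where p: "p = (i, j)" by fastforce
  have "(\<Sum>b\<in>UNIV. int (count (add_mset p M) (m, b))) =
      of_bool (i = m) + (\<Sum>b\<in>UNIV. int (count M (m, b)))"
    "(\<Sum>a\<in>UNIV. int (count (add_mset p M) (a, m))) =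
      of_bool (j = m) + (\<Sum>a\<in>UNIV. int (count M (a, m)))"
    using exhaust_3[of i] exhaust_3[of j] exhaust_3[of m] by (auto simp: p sum_3)
  then show ?case using add by (simp add: p weight_add_mset)
qed simp

definition short_cycles :: "(3 \<times> 3) list set" where
  "short_cycles = {[(1,1)], [(2,2)], [(3,3)], [(2,1),(1,2)], [(3,1),(1,3)], [(3,2),(2,3)]}"

text \<open>The letters are ordered as in \<open>K_elt_eq\<close>, so that \<open>K_elt\<close> is
  exactly the difference of the two triangle words.\<close>

definition triangle1 :: "(3 \<times> 3) list" where "triangle1 = [(3,1),(1,2),(2,3)]"
definition triangle2 :: "(3 \<times> 3) list" where "triangle2 = [(3,2),(2,1),(1,3)]"

lemma weight_cycles: "us \<in> short_cycles \<union> {triangle1, triangle2} \<Longrightarrow> weight (mset us) = (\<lambda>_. 0)"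
  by (auto simp: short_cycles_def triangle1_def triangle2_def weight_add_mset fun_eq_iff)

lemma distinct_mset_subseteq:
  assumes "distinct us" "set us \<subseteq> set_mset M"
  shows "mset us \<subseteq># M"
proof (rule mset_subset_eqI)
  fix a
  show "count (mset us) a \<le> count M a"
    using assms by (cases "a \<in> set us") (auto simp: distinct_count_atmost_1 Suc_le_eq)
qed

text \<open>The variables count the edges 12, 21, 13, 31, 23, 32. Without opposite edges, balance
  continues every edge to the third vertex and back, which closes a triangle.\<close>

lemma balanced_counts_zero:
  fixes a b c d e f :: nat
  assumes "a + c = b + d" "b + e = a + f" "a = 0 \<or> b = 0" "c = 0 \<or> d = 0" "e = 0 \<or> f = 0"
    "d = 0 \<or> a = 0 \<or> e = 0" "f = 0 \<or> b = 0 \<or> c = 0"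
  shows "a = 0 \<and> b = 0 \<and> c = 0 \<and> d = 0 \<and> e = 0 \<and> f = 0"
  using assms by (elim disjE) auto

text \<open>The listed cycles have distinct edges, so containment only requires positive
  multiplicities.\<close>

lemma cycle_decomposition:
  assumes "weight M = (\<lambda>_. 0)" "M \<noteq> {#}"
  obtains us where "us \<in> short_cycles \<union> {triangle1, triangle2}" "mset us \<subseteq># M"
proof -
  let ?c = "\<lambda>i j. count M (i, j)"
  have w: "?c 1 2 + ?c 1 3 = ?c 2 1 + ?c 3 1" "?c 2 1 + ?c 2 3 = ?c 1 2 + ?c 3 2"
    using fun_cong[OF assms(1), of 1] fun_cong[OF assms(1), of 2]
    unfolding weight_eq_counts sum_3 by linarith+
  obtain i j where ij: "?c i j > 0"
    using multiset_nonemptyE[OF assms(2)] by fastforce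
  have "?c 1 1 > 0 \<or> ?c 2 2 > 0 \<or> ?c 3 3 > 0 \<or> (?c 2 1 > 0 \<and> ?c 1 2 > 0) \<or>
      (?c 3 1 > 0 \<and> ?c 1 3 > 0) \<or> (?c 3 2 > 0 \<and> ?c 2 3 > 0) \<or>
      (?c 3 1 > 0 \<and> ?c 1 2 > 0 \<and> ?c 2 3 > 0) \<or>
      (?c 3 2 > 0 \<and> ?c 2 1 > 0 \<and> ?c 1 3 > 0)"
  proof (rule ccontr)
    assume neg: "\<not> ?thesis"
    then have "?c 1 2 = 0 \<and> ?c 2 1 = 0 \<and> ?c 1 3 = 0 \<and> ?c 3 1 = 0 \<and> ?c 2 3 = 0 \<and> ?c 3 2 = 0"
      unfolding neq0_conv[symmetric] by (intro balanced_counts_zero w) blast+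
    with neg ij show False
      using exhaust_3[of i] exhaust_3[of j] by (auto simp del: count_greater_zero_iff)
  qed
  then have "\<exists>us \<in> short_cycles \<union> {triangle1, triangle2}. distinct us \<and> set us \<subseteq> set_mset M"
    unfolding short_cycles_def triangle1_def triangle2_def
    by (elim disjE) simp_all
  then show ?thesis using that distinct_mset_subseteq by blast
qed

section \<open>Expressing cycles by the given elements\<close>

lemma lower_words_subalgebra:
  assumes "subalgebra A"
    and "\<And>qs. length qs < n \<Longrightarrow> weight (mset qs) = (\<lambda>_. 0) \<Longrightarrow> e_word qs \<in> A"
  shows "lower_words n (\<lambda>_. 0) \<subseteq> A"
  using assms by (intro uea.span_minimal) (auto simp: subalgebra_def)

text \<open>Up to shorter words of weight zero, \<open>e_word ps\<close> is \<open>e_word us\<close>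
  times the word of the remaining letters, which is itself shorter and of weight zero.\<close>

lemma e_word_split_off:
  assumes A: "subalgebra A"
    and lower: "\<And>qs. length qs < length ps \<Longrightarrow> weight (mset qs) = (\<lambda>_. 0) \<Longrightarrow> e_word qs \<in> A"
    and w: "weight (mset ps) = (\<lambda>_. 0)"
    and us: "e_word us \<in> A" "weight (mset us) = (\<lambda>_. 0)" "us \<noteq> []" "mset us \<subseteq># mset ps"
  shows "e_word ps \<in> A"
proof -
  obtain vs where vs: "mset vs = mset ps - mset us" using ex_mset by blast
  then have m: "mset ps = mset (us @ vs)" using us by simp
  then have "length ps = length us + length vs" using mset_eq_length[OF m] by simp
  then have len: "length vs < length ps" using us(3) by simp
  have "weight (mset vs) = (\<lambda>_. 0)"
    using w us(2) m by (auto simp: fun_eq_iff weight_union)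
  then have "e_word us * e_word vs \<in> A" using lower[OF len] us A by (simp add: subalgebra_closed)
  moreover have "e_word ps - e_word (us @ vs) \<in> A"
    using e_word_reorder[OF m] lower_words_subalgebra[OF A lower] w by auto
  ultimately have "(e_word ps - e_word (us @ vs)) + e_word us * e_word vs \<in> A"
    using subalgebra_closed(3)[OF A] by blast
  then show ?thesis by (simp add: e_word_append)
qed

lemma e_gen_swap:
  "e_gen i j * e_gen k l = e_gen k l * e_gen i j + commutator (e_gen i j) (e_gen k l)"
  by (simp add: commutator_def)

text \<open>\<open>H1\<close> and \<open>H2\<close> give the loops, \<open>J_elt\<close> and
  \<open>Jbar_elt\<close> two of the 2-cycles, and \<open>C2\<close> the third.\<close>

lemma short_words_in_hull:
  assumes A: "subalgebra A" and J: "J_elt \<in> A" "Jbar_elt \<in> A" and H: "H1 \<in> A" "H2 \<in> A" and C2: "C2 \<in> A"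
  shows "us \<in> short_cycles \<Longrightarrow> e_word us \<in> A"
proof -
  note closed = subalgebra_closed[OF A]
  \<comment> \<open>By the trace relation, three times \<open>e_gen 1 1\<close> is
    \<open>2 * (e_gen 1 1 - e_gen 2 2) + (e_gen 2 2 - e_gen 3 3)\<close>.\<close>
  have "uea_scale (4/3) H1 + uea_scale (2/3) H2 = e_gen 1 1"
  proof -
    have "uea_scale (4/3) H1 + uea_scale (2/3) H2 =
        uea_scale (2/3) (e_gen 1 1 - e_gen 2 2) + uea_scale (1/3) (e_gen 2 2 - e_gen 3 3)"
      by (simp add: H1_def H2_def)
    also have "\<dots> = uea_scale (2/3) (e_gen 1 1) + uea_scale (1/3) (e_gen 2 2 - e_gen 3 3 - 2 * e_gen 2 2)"
      using uea.scale_left_distrib[of "1/3" "1/3" "e_gen 2 2"]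
      by (simp add: uea.scale_right_diff_distrib uea.scale_right_distrib mult_2)
    also have "e_gen 2 2 - e_gen 3 3 - 2 * e_gen 2 2 = e_gen 1 1" by (simp add: e_gen_2_2 mult_2)
    also have "uea_scale (2/3) (e_gen 1 1) + uea_scale (1/3) (e_gen 1 1) = uea_scale (2/3 + 1/3) (e_gen 1 1)"
      by (rule uea.scale_left_distrib[symmetric])
    also have "\<dots> = e_gen 1 1" by simp
    finally show ?thesis .
  qed
  moreover have "uea_scale (4/3) H1 + uea_scale (2/3) H2 \<in> A" by (intro closed H)
  ultimately have d1: "e_gen 1 1 \<in> A" by simp
  have "e_gen 1 1 - uea_scale 2 H1 = e_gen 2 2" by (simp add: H1_def)
  then have d2: "e_gen 2 2 \<in> A" using closed(4)[OF d1 closed(5)[OF H(1), of 2]] by simp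
  have "e_gen 2 2 - uea_scale 2 H2 = e_gen 3 3" by (simp add: H2_def)
  then have d3: "e_gen 3 3 \<in> A" using closed(4)[OF d2 closed(5)[OF H(2), of 2]] by simp
  have d: "e_gen i i \<in> A" for i using exhaust_3[of i] d1 d2 d3 by auto
  have "J_elt - uea_scale (1/4) ((e_gen 1 1 - e_gen 2 2)^2 + 2 * (e_gen 1 1 - e_gen 2 2)) \<in> A"
    by (intro closed d J)
  then have p12: "e_gen 2 1 * e_gen 1 2 \<in> A" by (simp add: J_elt_def)
  have "Jbar_elt - uea_scale (1/4) ((e_gen 1 1 - e_gen 3 3)^2 + 2 * (e_gen 1 1 - e_gen 3 3)) \<in> A"
    by (intro closed d J)
  then have p13: "e_gen 3 1 * e_gen 1 3 \<in> A" by (simp add: Jbar_elt_def)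
  have s: "e_gen 1 2 * e_gen 2 1 = e_gen 2 1 * e_gen 1 2 + (e_gen 1 1 - e_gen 2 2)"
    "e_gen 1 3 * e_gen 3 1 = e_gen 3 1 * e_gen 1 3 + (e_gen 1 1 - e_gen 3 3)"
    "e_gen 2 3 * e_gen 3 2 = e_gen 3 2 * e_gen 2 3 + (e_gen 2 2 - e_gen 3 3)"
    by (simp_all add: e_gen_swap[of 1 2 2 1] e_gen_swap[of 1 3 3 1] e_gen_swap[of 2 3 3 2] e_gen_commutator)
  \<comment> \<open>\<open>C2\<close> contains each 2-cycle in both orders; after rewriting with
    \<open>s\<close>, the subtraction leaves twice the missing one.\<close>
  have "C2 - (e_gen 1 1 * e_gen 1 1 + e_gen 2 2 * e_gen 2 2 + e_gen 3 3 * e_gen 3 3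
      + (e_gen 2 1 * e_gen 1 2 + (e_gen 1 1 - e_gen 2 2)) + e_gen 2 1 * e_gen 1 2
      + (e_gen 3 1 * e_gen 1 3 + (e_gen 1 1 - e_gen 3 3)) + e_gen 3 1 * e_gen 1 3
      + (e_gen 2 2 - e_gen 3 3)) \<in> A" (is "?x \<in> A")
    by (intro closed d C2 p12 p13)
  moreover have "?x = 2 * (e_gen 3 2 * e_gen 2 3)"
    by (simp add: C2_def sum_3 s algebra_simps mult_2)
  moreover have "uea_scale (1/2) (2 * y) = y" for y :: "sl3 uea"
    using uea.scale_left_distrib[of "1/2" "1/2" y] by (simp add: mult_2 uea.scale_right_distrib)
  ultimately have p23: "e_gen 3 2 * e_gen 2 3 \<in> A" using closed(5)[of ?x "1/2"] by simp
  show "us \<in> short_cycles \<Longrightarrow> e_word us \<in> A"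
    using d p12 p13 p23 by (auto simp: short_cycles_def)
qed

text \<open>Words this short have no room for a triangle. They are the correction terms that arise
  when the letters of a triangle are permuted.\<close>

lemma short_zero_weight_words:
  assumes A: "subalgebra A" and short: "\<And>us. us \<in> short_cycles \<Longrightarrow> e_word us \<in> A"
    and ps: "length ps < 3" "weight (mset ps) = (\<lambda>_. 0)"
  shows "e_word ps \<in> A"
  using ps
proof (induction "length ps" arbitrary: ps rule: less_induct)
  case less
  show ?case
  proof (cases "ps = []")
    case True
    then show ?thesis by (simp add: subalgebra_closed[OF A])
  next
    case False
    then obtain us where us: "us \<in> short_cycles \<union> {triangle1, triangle2}" "mset us \<subseteq># mset ps"
      using cycle_decomposition[OF less.prems(2)] by auto
    have "length us < 3" using size_mset_mono[OF us(2)] less.prems(1) by simp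
    then have "us \<in> short_cycles" using us(1) by (auto simp: triangle1_def triangle2_def)
    moreover have "us \<noteq> []" using \<open>us \<in> short_cycles\<close> by (auto simp: short_cycles_def)
    ultimately show ?thesis
      using less us(2) weight_cycles[of us] short
      by (intro e_word_split_off[OF A _ _ _ _ _ us(2)]) auto
  qed
qed

text \<open>Distinct indices give a rotation of one of the triangles; a repeated index gives a loop,
  which splits off.\<close>

lemma triangle_congruence:
  assumes A: "subalgebra A" and short: "\<And>us. us \<in> short_cycles \<Longrightarrow> e_word us \<in> A"
  shows "e_word [(i, j), (j, k), (k, i)] -
    (if (i, j, k) \<in> {(3,1,2), (1,2,3), (2,3,1)} then e_word triangle1
     else if (i, j, k) \<in> {(3,2,1), (2,1,3), (1,3,2)} then e_word triangle2 else 0) \<in> A"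
proof -
  let ?w = "[(i, j), (j, k), (k, i)]"
  have w0: "weight (mset ?w) = (\<lambda>_. 0)" by (simp add: weight_add_mset fun_eq_iff)
  have lower: "e_word qs \<in> A" if "length qs < length ?w" "weight (mset qs) = (\<lambda>_. 0)" for qs
    using short_zero_weight_words[OF A short] that by simp
  have reorder: "e_word ?w - e_word qs \<in> A" if "mset ?w = mset qs" for qs
    using e_word_reorder[OF that] lower_words_subalgebra[OF A lower] w0 by auto
  show ?thesis
  proof (cases "(i, j, k) \<in> {(3,1,2), (1,2,3), (2,3,1)}")
    case True
    then have "mset ?w = mset triangle1" by (auto simp: triangle1_def)
    from reorder[OF this] show ?thesis by (simp only: if_P[OF True])
  next
    case n1: False
    show ?thesis
    proof (cases "(i, j, k) \<in> {(3,2,1), (2,1,3), (1,3,2)}")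
      case True
      then have "mset ?w = mset triangle2" by (auto simp: triangle2_def)
      from reorder[OF this] show ?thesis by (simp only: if_not_P[OF n1] if_P[OF True])
    next
      case False
      with n1 have "i = j \<or> j = k \<or> k = i"
        using exhaust_3[of i] exhaust_3[of j] exhaust_3[of k] by auto
      then obtain m where m: "mset [(m, m)] \<subseteq># mset ?w" by auto
      have sc: "[(m, m)] \<in> short_cycles" using exhaust_3[of m] by (auto simp: short_cycles_def)
      have "e_word ?w \<in> A"
        using sc m weight_cycles[of "[(m, m)]"]
        by (intro e_word_split_off[OF A lower w0 short[OF sc]]) auto
      then show ?thesis by (simp only: if_not_P[OF n1] if_not_P[OF False] diff_zero)
    qed
  qed
qed

text \<open>Modulo \<open>A\<close>, \<open>C3\<close> is three times the sum of the triangle words,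
  while \<open>K_elt\<close> is their difference; hence six times one of them lies in
  \<open>A\<close>.\<close>

lemma triangles_in_subalgebra:
  assumes A: "subalgebra A" and short: "\<And>us. us \<in> short_cycles \<Longrightarrow> e_word us \<in> A"
    and K: "K_elt \<in> A" and C3: "C3 \<in> A"
  shows "e_word triangle1 \<in> A" "e_word triangle2 \<in> A"
proof -
  note closed = subalgebra_closed[OF A]
  define t where "t i j k = (if (i, j, k) \<in> {(3,1,2), (1,2,3), (2,3,1)} then e_word triangle1
     else if (i, j, k) \<in> {(3,2,1), (2,1,3), (1,3,2)} then e_word triangle2 else 0)" for i j k :: 3
  define T1 T2 where "T1 = e_word triangle1" and "T2 = e_word triangle2"
  have "(\<Sum>i\<in>UNIV. \<Sum>j\<in>UNIV. \<Sum>k\<in>UNIV. e_word [(i, j), (j, k), (k, i)] - t i j k) \<in> A"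
    unfolding t_def by (intro closed triangle_congruence[OF A short])
  moreover have "(\<Sum>i\<in>UNIV. \<Sum>j\<in>UNIV. \<Sum>k\<in>UNIV. t i j k) = T1 + T1 + T1 + T2 + T2 + T2"
    by (simp add: t_def sum_3 T1_def T2_def algebra_simps)
  ultimately have "C3 - (T1 + T1 + T1 + T2 + T2 + T2) \<in> A"
    by (simp add: C3_def sum_subtractf mult.assoc)
  from closed(4)[OF C3 this] have S: "T1 + T1 + T1 + T2 + T2 + T2 \<in> A"
    by (simp only: diff_diff_eq2 add_diff_cancel_left')
  have D: "T1 - T2 \<in> A"
    using K by (simp add: K_elt_eq T1_def T2_def triangle1_def triangle2_def mult.assoc)
  have "T1 + T1 + T1 + T2 + T2 + T2 + (T1 - T2) + (T1 - T2) + (T1 - T2) \<in> A"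
    by (intro closed S D)
  moreover have "T1 + T1 + T1 + T2 + T2 + T2 + (T1 - T2) + (T1 - T2) + (T1 - T2) =
      T1 + T1 + T1 + T1 + T1 + T1" by simp
  moreover have "T1 + T1 + T1 + T1 + T1 + T1 = uea_scale 6 T1"
    using uea.scale_left_distrib[of 5 1 T1] uea.scale_left_distrib[of 4 1 T1]
      uea.scale_left_distrib[of 3 1 T1] uea.scale_left_distrib[of 2 1 T1]
      uea.scale_left_distrib[of 1 1 T1] by simp
  ultimately have "uea_scale 6 T1 \<in> A" by simp
  from closed(5)[OF this, of "1/6"] have T1: "T1 \<in> A" by simp
  moreover have "T1 - (T1 - T2) \<in> A" by (intro closed T1 D)
  ultimately show "e_word triangle1 \<in> A" "e_word triangle2 \<in> A" by (simp_all add: T1_def T2_def)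
qed

theorem cartan_centralizer_generated:
  "subalgebra hull {J_elt, Jbar_elt, K_elt, H1, H2, C2, C3} = cartan_centralizer" (is "?A = _")
proof
  show "?A \<subseteq> cartan_centralizer"
    by (intro hull_minimal generators_cartan_centralizer subalgebra_cartan_centralizer)
  have A: "subalgebra ?A" by (rule subalgebra_hull)
  have short: "e_word us \<in> ?A" if "us \<in> short_cycles" for us
    by (rule short_words_in_hull[OF A _ _ _ _ _ that]) (auto intro!: hull_inc)
  have "K_elt \<in> ?A" "C3 \<in> ?A" by (auto intro!: hull_inc)
  note triangles = triangles_in_subalgebra[OF A short this]
  have words: "e_word ps \<in> ?A" if "weight (mset ps) = (\<lambda>_. 0)" for ps
    using that
  proof (induction "length ps" arbitrary: ps rule: less_induct)
    case less
    show ?case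
    proof (cases "ps = []")
      case True
      then show ?thesis by (simp add: subalgebra_closed[OF A])
    next
      case False
      then obtain us where us: "us \<in> short_cycles \<union> {triangle1, triangle2}" "mset us \<subseteq># mset ps"
        using cycle_decomposition[OF less.prems] by auto
      have "us \<noteq> []" using us(1) by (auto simp: short_cycles_def triangle1_def triangle2_def)
      moreover have "e_word us \<in> ?A" using us(1) short triangles by blast
      ultimately show ?thesis
        using less us weight_cycles[OF us(1)] by (intro e_word_split_off[OF A _ _ _ _ _ us(2)])
    qed
  qed
  show "cartan_centralizer \<subseteq> ?A"
  proof
    fix x assume x: "x \<in> cartan_centralizer"
    obtain k where "x \<in> sl3_filtration k" by (rule sl3_filtration_exhaustive)
    with x have "x \<in> uea.span (e_monom ` zero_monoms k)"
      using cartan_centralizer_filtration by blast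
    moreover have "uea.span (e_monom ` zero_monoms k) \<subseteq> ?A"
    proof (intro uea.span_minimal image_subsetI)
      fix M assume "M \<in> zero_monoms k"
      then show "e_monom M \<in> ?A"
        using words by (metis (mono_tags, lifting) e_monom_word mem_Collect_eq zero_monoms_def)
    qed (use A in \<open>simp add: subalgebra_def\<close>)
    ultimately show "x \<in> ?A" by blast
  qed
qed

section \<open>The Hilbert series\<close>

definition counting_series :: "'a set \<Rightarrow> ('a \<Rightarrow> nat) \<Rightarrow> rat fps" where
  "counting_series A d = Abs_fps (\<lambda>k. of_nat (card {x \<in> A. d x = k}))"

lemma counting_series_Times:
  assumes "\<And>k. finite {x \<in> A. d x = k}" "\<And>k. finite {y \<in> B. e y = k}"
  shows "counting_series (A \<times> B) (\<lambda>(x, y). d x + e y) = counting_series A d * counting_series B e"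
proof (rule fps_ext)
  fix n
  have "{z \<in> A \<times> B. (case z of (x, y) \<Rightarrow> d x + e y) = n} =
      (\<Union>i\<in>{0..n}. {x \<in> A. d x = i} \<times> {y \<in> B. e y = n - i})"
    by auto
  also have "card \<dots> = (\<Sum>i=0..n. card ({x \<in> A. d x = i} \<times> {y \<in> B. e y = n - i}))"
    using assms by (intro card_UN_disjoint) auto
  finally show "fps_nth (counting_series (A \<times> B) (\<lambda>(x, y). d x + e y)) n =
      fps_nth (counting_series A d * counting_series B e) n"
    by (simp add: counting_series_def fps_mult_nth card_cartesian_product)
qed

text \<open>The geometric series in \<open>fps_X ^ c\<close>, stated without division.\<close>

lemma counting_series_multiples:
  assumes "c > 0"
  shows "counting_series UNIV (\<lambda>n. c * n) * (1 - fps_X ^ c) = 1"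
proof (rule fps_ext)
  fix n
  have card: "card {m. c * m = k} = (if c dvd k then 1 else 0)" for k
  proof (cases "c dvd k")
    case True
    then have "{m. c * m = k} = {k div c}" using assms by auto
    then show ?thesis using True by simp
  next
    case False
    then have "{m. c * m = k} = {}" by auto
    then show ?thesis using False by simp
  qed
  have "counting_series UNIV (\<lambda>n. c * n) * (1 - fps_X ^ c) =
      counting_series UNIV (\<lambda>n. c * n) - fps_X ^ c * counting_series UNIV (\<lambda>n. c * n)"
    by (simp add: algebra_simps)
  then show "fps_nth (counting_series UNIV (\<lambda>n. c * n) * (1 - fps_X ^ c)) n = fps_nth 1 n"
    using assms by (auto simp: counting_series_def card fps_X_power_mult_nth dvd_minus_self
        dest: dvd_imp_le)
qed

lemma finite_multiples: "c > 0 \<Longrightarrow> finite {n. c * n = (k::nat)}"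
  by (rule finite_subset[of _ "{..k}"]) auto

lemma counting_series_bij:
  assumes "bij_betw f A B" "\<And>x. x \<in> A \<Longrightarrow> e (f x) = d x"
  shows "counting_series B e = counting_series A d"
proof -
  have "card {y \<in> B. e y = k} = card {x \<in> A. d x = k}" for k
  proof -
    have "{y \<in> B. e y = k} = f ` {x \<in> A. d x = k}"
      using assms by (auto simp: bij_betw_def)
    moreover have "inj_on f {x \<in> A. d x = k}"
      using assms(1) by (auto simp: bij_betw_def intro: inj_on_subset)
    ultimately show ?thesis by (simp add: card_image)
  qed
  then show ?thesis by (simp add: counting_series_def)
qed

text \<open>The pair \<open>(m, s)\<close> encodes an integer: \<open>m\<close> triangles of one orientation, or \<open>Suc m\<close> of the other.\<close>

fun cycle_sum :: "nat \<times> nat \<times> nat \<times> nat \<times> nat \<times> nat \<times> bool \<Rightarrow> (3 \<times> 3) multiset" where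
  "cycle_sum (a, b, p, q, r, m, s) =
     (let u = (if s then 0 else m); v = (if s then Suc m else 0) in
      replicate_mset a (1,1) + replicate_mset b (3,3) +
      replicate_mset (p + u) (1,2) + replicate_mset (p + v) (2,1) +
      replicate_mset (q + u) (3,1) + replicate_mset (q + v) (1,3) +
      replicate_mset (r + u) (2,3) + replicate_mset (r + v) (3,2))"

text \<open>Balance makes the differences of the multiplicities of 12 and 21, of 31 and 13, and of
  23 and 32 equal. Their common value is the encoded integer; the smaller multiplicity in each pair
  counts the 2-cycles.\<close>

lemma bij_betw_cycle_sum: "bij_betw cycle_sum UNIV {M \<in> pbw_monoms. weight M = (\<lambda>_. 0)}"
proof (rule bij_betw_imageI)
  show "inj cycle_sum"
  proof (rule injI)
    fix x y assume eq: "cycle_sum x = cycle_sum y"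
    obtain a b p q r m s where x: "x = (a, b, p, q, r, m, s)" by (metis prod_cases7)
    obtain a' b' p' q' r' m' s' where y: "y = (a', b', p', q', r', m', s')" by (metis prod_cases7)
    have "count (cycle_sum x) z = count (cycle_sum y) z" for z using eq by simp
    from this[of "(1,1)"] this[of "(3,3)"] this[of "(1,2)"] this[of "(2,1)"] this[of "(3,1)"]
      this[of "(1,3)"] this[of "(2,3)"] this[of "(3,2)"]
    show "x = y" by (cases s; cases s') (simp_all add: x y)
  qed
  show "range cycle_sum = {M \<in> pbw_monoms. weight M = (\<lambda>_. 0)}"
  proof (intro equalityI subsetI)
    fix M assume "M \<in> range cycle_sum"
    then obtain x where M: "M = cycle_sum x" by blast
    obtain a b p q r m s where x: "x = (a, b, p, q, r, m, s)" by (metis prod_cases7)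
    have "weight M i = 0" for i
      using exhaust_3[of i] by (auto simp: M x weight_eq_counts sum_3)
    then show "M \<in> {M \<in> pbw_monoms. weight M = (\<lambda>_. 0)}"
      by (auto simp: pbw_monoms_def M x fun_eq_iff Let_def simp flip: count_greater_zero_iff)
  next
    fix M assume "M \<in> {M \<in> pbw_monoms. weight M = (\<lambda>_. 0)}"
    then have 22: "count M (2, 2) = 0" and w: "weight M i = 0" for i
      by (auto simp: pbw_monoms_def not_in_iff)
    let ?c = "\<lambda>i j. count M (i, j)"
    have w1: "?c 1 2 + ?c 1 3 = ?c 2 1 + ?c 3 1" and w2: "?c 2 1 + ?c 2 3 = ?c 1 2 + ?c 3 2"
      using w[of 1] w[of 2] unfolding weight_eq_counts sum_3 by linarith+
    \<comment> \<open>The sign of the common difference decides the orientation; \<open>- 1\<close>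
      compensates for \<open>Suc m\<close> in \<open>cycle_sum\<close>.\<close>
    define x where "x = (?c 1 1, ?c 3 3, if ?c 2 1 \<le> ?c 1 2
      then (?c 2 1, ?c 1 3, ?c 3 2, ?c 1 2 - ?c 2 1, False)
      else (?c 1 2, ?c 3 1, ?c 2 3, ?c 2 1 - ?c 1 2 - 1, True))"
    have "count (cycle_sum x) (i, j) = count M (i, j)" for i j
      using exhaust_3[of i] exhaust_3[of j] w1 w2 22
      by (cases "?c 2 1 \<le> ?c 1 2") (elim disjE; simp add: x_def)+
    then have "cycle_sum x = M" by (intro multiset_eqI) auto
    then show "M \<in> range cycle_sum" by blast
  qed
qed

lemma finite_multiples_add:
  assumes "c > 0" "\<And>k. finite {y. e y = (k :: nat)}"
  shows "finite {z. (case z of (n, y) \<Rightarrow> c * n + e y) = k}"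
proof (rule finite_subset)
  show "{z. (case z of (n, y) \<Rightarrow> c * n + e y) = k} \<subseteq>
      (\<Union>i\<le>k. {n. c * n = i}) \<times> (\<Union>i\<le>k. {y. e y = i})" by auto
qed (intro finite_cartesian_product finite_UN_I finite_atMost finite_multiples assms)

lemma counting_series_multiples_add:
  assumes "c > 0" "\<And>k. finite {y. e y = k}"
  shows "counting_series UNIV (\<lambda>(n, y). c * n + e y) * (1 - fps_X ^ c) = counting_series UNIV e"
proof -
  have "counting_series UNIV (\<lambda>(n, y). c * n + e y) =
      counting_series UNIV (\<lambda>n. c * n) * counting_series UNIV e"
    using counting_series_Times[of UNIV "\<lambda>n. c * n" UNIV e] assms finite_multiples by simp
  then show ?thesis using counting_series_multiples[OF assms(1)] by (simp add: ac_simps)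
qed

text \<open>Loops have degree 1, 2-cycles degree 2 and triangles degree 3. The Boolean contributes
  the numerator, because \<open>True\<close> stands for one additional triangle.\<close>

lemma counting_series_pbw:
  "counting_series {M \<in> pbw_monoms. weight M = (\<lambda>_. 0)} size =
     (1 + fps_X ^ 3) / ((1 - fps_X) ^ 2 * (1 - fps_X ^ 2) ^ 3 * (1 - fps_X ^ 3))"
    (is "?F = ?N / ?D")
proof -
  define d0 :: "bool \<Rightarrow> nat" where "d0 = (\<lambda>s. if s then 3 else 0)"
  \<comment> \<open>The degrees are built from the innermost component outwards, so that each of the
    \<open>steps\<close> strips the first component of the tuple.\<close>
  define d1 where "d1 = (\<lambda>(m, y). 3 * m + d0 y)"
  define d2 where "d2 = (\<lambda>(r, y). 2 * r + d1 y)"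
  define d3 where "d3 = (\<lambda>(q, y). 2 * q + d2 y)"
  define d4 where "d4 = (\<lambda>(p, y). 2 * p + d3 y)"
  define d5 where "d5 = (\<lambda>(b, y). 1 * b + d4 y)"
  define d6 where "d6 = (\<lambda>(a, y). 1 * a + d5 y)"
  note d_defs = d0_def d1_def d2_def d3_def d4_def d5_def d6_def
  have f0: "finite {y. d0 y = k}" for k by simp
  have f1: "finite {y. d1 y = k}" for k unfolding d1_def by (rule finite_multiples_add[OF _ f0]) simp
  have f2: "finite {y. d2 y = k}" for k unfolding d2_def by (rule finite_multiples_add[OF _ f1]) simp
  have f3: "finite {y. d3 y = k}" for k unfolding d3_def by (rule finite_multiples_add[OF _ f2]) simp
  have f4: "finite {y. d4 y = k}" for k unfolding d4_def by (rule finite_multiples_add[OF _ f3]) simp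
  have f5: "finite {y. d5 y = k}" for k unfolding d5_def by (rule finite_multiples_add[OF _ f4]) simp
  have steps: "counting_series UNIV d6 * (1 - fps_X ^ 1) = counting_series UNIV d5"
    "counting_series UNIV d5 * (1 - fps_X ^ 1) = counting_series UNIV d4"
    "counting_series UNIV d4 * (1 - fps_X ^ 2) = counting_series UNIV d3"
    "counting_series UNIV d3 * (1 - fps_X ^ 2) = counting_series UNIV d2"
    "counting_series UNIV d2 * (1 - fps_X ^ 2) = counting_series UNIV d1"
    "counting_series UNIV d1 * (1 - fps_X ^ 3) = counting_series UNIV d0"
    using counting_series_multiples_add[OF _ f0, of 3] counting_series_multiples_add[OF _ f1, of 2]
      counting_series_multiples_add[OF _ f2, of 2] counting_series_multiples_add[OF _ f3, of 2]
      counting_series_multiples_add[OF _ f4, of 1] counting_series_multiples_add[OF _ f5, of 1]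
    unfolding d1_def[symmetric] d2_def[symmetric] d3_def[symmetric] d4_def[symmetric]
      d5_def[symmetric] d6_def[symmetric] by simp_all
  have F: "?F = counting_series UNIV d6"
    by (rule counting_series_bij[OF bij_betw_cycle_sum]) (auto simp: Let_def d_defs)
  have "?F * ?D = counting_series UNIV d6 * (1 - fps_X ^ 1) * (1 - fps_X ^ 1) *
      (1 - fps_X ^ 2) * (1 - fps_X ^ 2) * (1 - fps_X ^ 2) * (1 - fps_X ^ 3)"
    unfolding F by (simp add: power2_eq_square[of "1 - _"] power3_eq_cube[of "1 - _"] mult.assoc)
  also have "\<dots> = counting_series UNIV d0" by (simp only: steps)
  also have "\<dots> = ?N"
  proof (rule fps_ext)
    fix n :: nat
    have "{s. d0 s = n} = (if n = 3 then {True} else if n = 0 then {False} else {})"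
      by (auto simp: d0_def)
    then show "fps_nth (counting_series UNIV d0) n = fps_nth ?N n"
      by (simp add: counting_series_def)
  qed
  finally have FD: "?F * ?D = ?N" .
  \<comment> \<open>Cancelling the denominator requires \<open>?D \<noteq> 0\<close>, which follows
    from the product being nonzero.\<close>
  have "?N \<noteq> 0"
  proof
    assume "?N = 0"
    then have "fps_nth ?N 0 = 0" by (simp only: fps_zero_nth)
    then show False by simp
  qed
  have "?D \<noteq> 0"
  proof
    assume "?D = 0"
    then have "?F * ?D = 0" by (simp only: mult_zero_right)
    then have "?N = 0" unfolding FD .
    with \<open>?N \<noteq> 0\<close> show False by contradiction
  qed
  then show ?thesis
    unfolding FD[symmetric] by (rule nonzero_mult_div_cancel_right[symmetric])
qed

theorem proposition8p1:
  shows "subalgebra hull {J_elt, Jbar_elt, K_elt, H1, H2, C2, C3} = cartan_centralizer \<and>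
    hilbert_series cartan_centralizer =
      (1 + fps_X ^ 3) / ((1 - fps_X) ^ 2 * (1 - fps_X ^ 2) ^ 3 * (1 - fps_X ^ 3))"
proof
  show "subalgebra hull {J_elt, Jbar_elt, K_elt, H1, H2, C2, C3} = cartan_centralizer"
    by (rule cartan_centralizer_generated)
  show "hilbert_series cartan_centralizer =
      (1 + fps_X ^ 3) / ((1 - fps_X) ^ 2 * (1 - fps_X ^ 2) ^ 3 * (1 - fps_X ^ 3))"
    using counting_series_pbw
    by (simp add: hilbert_series_cartan_centralizer counting_series_def conj_assoc)
qed

end
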